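(* Let $\Omega,\Omega'\in\mathrm{RTSeq}_n$ and suppose $\Omega$ and $\Omega'$ have the same image in the augmented Thompson monoid $\widetilde{\mathrm{Th}}$. Then $$u(\Omega)^{-1}\cdot X(\Omega)=u(\Omega')^{-1}\cdot X(\Omega')\subset\mathrm{Fl}_n,$$ where a permutation acts on $\mathrm{Fl}_n=GL_n/B$ by left multiplication by its permutation matrix.
   Context: The augmented Thompson monoid $\widetilde{\mathrm{Th}}$ is the quotient of the free monoid on letters $\{T_j,R_j: j\ge1\}$ by the relations $T_iT_j=T_jT_{i+1}$ for $i>j$; $T_iR_j=R_jT_{i+1}$ for $i\ge j$; $R_iT_j=T_jR_{i+1}$ for $i>j$; $R_iR_j=R_jR_{i+1}$ for $i\ge j$. $\mathrm{Fl}_n=GL_n(\mathbb C)/B$ with $B$ upper triangular, $B^-$ lower triangular; $X^w=\overline{BwB/B}$, $X_w=\overline{B^-wB/B}$, Richardson variety $X^v_u=X^v\cap X_u$. For $w\in S_m$ and $1\le i\le m+1$, $\epsilon_i(w)\in S_{m+1}$ is defined by $\epsilon_i(w)(j)=w(j)+1$ for $j<i$, $\epsilon_i(w)(i)=1$, $\epsilon_i(w)(j)=w(j-1)+1$ for $j>i$. $\mathrm{RTSeq}_n$ is the set of words $\Omega=X_1\cdots X_n$ with $X_i\in\{R_1,T_1,\dots,R_{i-1},T_{i-1},R_i\}$. Recursively $u(\emptyset)=v(\emptyset)=\mathrm{id}$, and for $\Omega=\Omega'X$: $(u,v)(\Omega)=(\epsilon_ju(\Omega'),\epsilon_jv(\Omega'))$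 if $X=R_j$, $(\epsilon_ju(\Omega'),\epsilon_{j+1}v(\Omega'))$ if $X=T_j$. Set $X(\Omega)=X^{v(\Omega)}_{u(\Omega)}$. *)

theory Defs
  imports "HOL-Analysis.Analysis"
begin

type_synonym cmat = "nat \<Rightarrow> nat \<Rightarrow> complex"

definition is_mat :: "nat \<Rightarrow> cmat \<Rightarrow> bool" where
  "is_mat n M \<longleftrightarrow> (\<forall>i j. (i \<notin> {1..n} \<or> j \<notin> {1..n}) \<longrightarrow> M i j = 0)"

definition mmult :: "nat \<Rightarrow> cmat \<Rightarrow> cmat \<Rightarrow> cmat" where
  "mmult n A B = (\<lambda>i j. if i \<in> {1..n} \<and> j \<in> {1..n} then (\<Sum>k\<in>{1..n}. A i k * B k j) else 0)"

definition mdet :: "nat \<Rightarrow> cmat \<Rightarrow> complex" where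
  "mdet n M = (\<Sum>p | p permutes {1..n}. of_int (sign p) * (\<Prod>i\<in>{1..n}. M i (p i)))"

definition GL :: "nat \<Rightarrow> cmat set" where
  "GL n = {M. is_mat n M \<and> mdet n M \<noteq> 0}"

definition Borel :: "nat \<Rightarrow> cmat set" where
  "Borel n = {M \<in> GL n. \<forall>i j. j < i \<longrightarrow> M i j = 0}"

definition Borel_minus :: "nat \<Rightarrow> cmat set" where
  "Borel_minus n = {M \<in> GL n. \<forall>i j. i < j \<longrightarrow> M i j = 0}"

definition coset :: "nat \<Rightarrow> cmat \<Rightarrow> cmat set" where
  "coset n g = (\<lambda>b. mmult n g b) ` Borel n"

definition Fl :: "nat \<Rightarrow> cmat set set" where
  "Fl n = coset n ` GL n"

text \<open>Quotient topology on GL_n/B induced by the (Euclidean = product) topology on GL_n.\<close>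
definition Fl_top :: "nat \<Rightarrow> cmat set topology" where
  "Fl_top n = topology (\<lambda>U. U \<subseteq> Fl n \<and> openin (top_of_set (GL n)) (\<Union>U))"

definition act :: "nat \<Rightarrow> cmat \<Rightarrow> cmat set set \<Rightarrow> cmat set set" where
  "act n g S = (\<lambda>C. (\<lambda>h. mmult n g h) ` C) ` S"

definition perm_mat :: "nat \<Rightarrow> (nat \<Rightarrow> nat) \<Rightarrow> cmat" where
  "perm_mat n w = (\<lambda>i j. if i \<in> {1..n} \<and> j \<in> {1..n} \<and> i = w j then 1 else 0)"

definition perm_inv :: "nat \<Rightarrow> (nat \<Rightarrow> nat) \<Rightarrow> (nat \<Rightarrow> nat)" where
  "perm_inv n w = inv_into {1..n} w"

definition schubert_upper :: "nat \<Rightarrow> (nat \<Rightarrow> nat) \<Rightarrow> cmat set set" where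
  "schubert_upper n w = Fl_top n closure_of
     {coset n (mmult n b (perm_mat n w)) | b. b \<in> Borel n}"

definition schubert_lower :: "nat \<Rightarrow> (nat \<Rightarrow> nat) \<Rightarrow> cmat set set" where
  "schubert_lower n w = Fl_top n closure_of
     {coset n (mmult n b (perm_mat n w)) | b. b \<in> Borel_minus n}"

definition richardson :: "nat \<Rightarrow> (nat \<Rightarrow> nat) \<Rightarrow> (nat \<Rightarrow> nat) \<Rightarrow> cmat set set" where
  "richardson n v u = schubert_upper n v \<inter> schubert_lower n u"

datatype letter = R nat | T nat

definition eps :: "nat \<Rightarrow> (nat \<Rightarrow> nat) \<Rightarrow> (nat \<Rightarrow> nat)" where
  "eps i w = (\<lambda>j. if j < i then w j + 1 else if j = i then 1 else w (j - 1) + 1)"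

fun uv_step :: "(nat \<Rightarrow> nat) \<times> (nat \<Rightarrow> nat) \<Rightarrow> letter \<Rightarrow> (nat \<Rightarrow> nat) \<times> (nat \<Rightarrow> nat)" where
  "uv_step (u, v) (R j) = (eps j u, eps j v)"
| "uv_step (u, v) (T j) = (eps j u, eps (Suc j) v)"

definition uv :: "letter list \<Rightarrow> (nat \<Rightarrow> nat) \<times> (nat \<Rightarrow> nat)" where
  "uv w = foldl uv_step (id, id) w"

definition u_of :: "letter list \<Rightarrow> nat \<Rightarrow> nat" where "u_of w = fst (uv w)"
definition v_of :: "letter list \<Rightarrow> nat \<Rightarrow> nat" where "v_of w = snd (uv w)"

text \<open>X_i (1-based position i) lies in {R_1,T_1,...,R_{i-1},T_{i-1},R_i}.\<close>
definition RTSeq :: "nat \<Rightarrow> letter list set" where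
  "RTSeq n = {w. length w = n \<and>
     (\<forall>k < n. (\<exists>j. w ! k = R j \<and> 1 \<le> j \<and> j \<le> Suc k) \<or> (\<exists>j. w ! k = T j \<and> 1 \<le> j \<and> j \<le> k))}"

definition X_of :: "nat \<Rightarrow> letter list \<Rightarrow> cmat set set" where
  "X_of n w = richardson n (v_of w) (u_of w)"

inductive th_rel :: "letter list \<Rightarrow> letter list \<Rightarrow> bool" where
  TT: "1 \<le> j \<Longrightarrow> j < i \<Longrightarrow> th_rel [T i, T j] [T j, T (Suc i)]"
| TR: "1 \<le> j \<Longrightarrow> j \<le> i \<Longrightarrow> th_rel [T i, R j] [R j, T (Suc i)]"
| RT: "1 \<le> j \<Longrightarrow> j < i \<Longrightarrow> th_rel [R i, T j] [T j, R (Suc i)]"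
| RR: "1 \<le> j \<Longrightarrow> j \<le> i \<Longrightarrow> th_rel [R i, R j] [R j, R (Suc i)]"

text \<open>Monoid congruence generated by th_rel: equality of images in the augmented Thompson monoid.\<close>
inductive th_eq :: "letter list \<Rightarrow> letter list \<Rightarrow> bool" where
  step: "th_rel x y \<Longrightarrow> th_eq (a @ x @ b) (a @ y @ b)"
| refl: "th_eq w w"
| sym: "th_eq w w' \<Longrightarrow> th_eq w' w"
| trans: "th_eq w w' \<Longrightarrow> th_eq w' w'' \<Longrightarrow> th_eq w w''"

end

theory Submission
  imports Defs "Jordan_Normal_Form.Determinant"
begin

text \<open>
  We describe \<open>u(\<Omega>)\<^sup>-\<^sup>1 \<cdot> X(\<Omega>)\<close> by a recursion that depends on \<open>\<Omega>\<close> only through its letters.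
  Let \<open>\<phi>\<^sub>j\<close> insert a unit row and column at position \<open>j\<close>, and let \<open>P\<close> be the Borel subgroup for the
  letter \<open>R\<^sub>j\<close> and the minimal parabolic subgroup of the columns \<open>j, j + 1\<close> for \<open>T\<^sub>j\<close>.
  On preimages in \<open>GL\<close>, appending the letter replaces \<open>Y\<close> by \<open>\<phi>\<^sub>j(Y) P\<close>.
  Since \<open>P = L B\<close> with a set \<open>L\<close> of representatives supported in the rows \<open>j, j + 1\<close>, two successive
  letters give \<open>\<phi>\<^sub>j(\<phi>\<^sub>i(Y)) \<phi>\<^sub>j(L) L' B\<close>, and the Thompson relations follow from
  \<open>\<phi>\<^sub>j \<circ> \<phi>\<^sub>i = \<phi>\<^bsub>i + 1\<^esub> \<circ> \<phi>\<^sub>j\<close> for \<open>j \<le> i\<close> and the commutation of disjoint blocks.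

  For the recursion, both Schubert conditions of the larger Richardson variety are closures of double
  cosets that are stable under \<open>P\<close> on the right. The lower condition makes the first row of a matrix
  \<open>g\<close> vanish before column \<open>j\<close>, and the upper one makes the first column of \<open>g\<^sup>-\<^sup>1\<close> vanish below the
  block of \<open>P\<close>, so an element of \<open>P\<close> moves \<open>g\<close> to a matrix with a unit row 1 and unit column \<open>j\<close>.
  Deleting that row and column (for the upper condition), respectively taking the Schur complement
  (for the lower one), is a continuous operation that maps double cosets to double cosets.
\<close>

subsection \<open>Matrices indexed from 1\<close>

text \<open>Bridge to 0-based matrices, from which multiplicativity of determinants and existence of
  inverses are transferred. Entries outside 1..n are forgotten, so it is injective only on matrices
  satisfying \<open>is_mat\<close>.\<close>

definition jnf :: "nat \<Rightarrow> cmat \<Rightarrow> complex mat" where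
  "jnf n M = mat n n (\<lambda>(i, j). M (Suc i) (Suc j))"

lemma jnf_carrier [simp]: "jnf n M \<in> carrier_mat n n"
  by (simp add: jnf_def)

text \<open>Conjugation by the shift \<open>Suc\<close> matches the permutations of the two index
  sets and preserves both sign and product.\<close>

lemma mdet_eq_det: "mdet n M = det (jnf n M)"
proof -
  have bij: "bij_betw Suc {0..<n} {1..n}"
    by (rule bij_betwI[where g = "\<lambda>x. x - 1"]) auto
  have bij': "bij_betw (\<lambda>x. x - 1) {1..n} {0..<n}"
    by (rule bij_betwI[where g = Suc]) auto
  have "mdet n M = (\<Sum>p | p permutes {0..<n}.
      of_int (sign p) * (\<Prod>i = 0..<n. jnf n M $$ (i, p i)))"
    unfolding mdet_def
  proof (rule sum.reindex_bij_witness[where i = "map_permutation {0..<n} Suc"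
        and j = "map_permutation {1..n} (\<lambda>x. x - 1)"])
    fix p assume "p \<in> {p. p permutes {1..n}}"
    then have p: "p permutes {1..n}" by simp
    show "map_permutation {0..<n} Suc (map_permutation {1..n} (\<lambda>x. x - 1) p) = p"
      by (rule map_permutation_compose_inv[OF bij' p]) auto
    show q: "map_permutation {1..n} (\<lambda>x. x - 1) p \<in> {p. p permutes {0..<n}}"
      using map_permutation_permutes[OF bij' p] by simp
    let ?q = "map_permutation {1..n} (\<lambda>x. x - 1) p"
    have ap: "?q i = p (Suc i) - 1" if "i < n" for i
      using map_permutation_apply[of "\<lambda>x. x - 1" "{1..n}" "Suc i" p] that bij'
      by (simp add: bij_betw_def)
    have mem: "p (Suc i) \<in> {1..n}" if "i < n" for i
      using permutes_in_image[OF p, of "Suc i"] that by simp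
    have "(\<Prod>i = 0..<n. jnf n M $$ (i, ?q i)) = (\<Prod>i = 0..<n. M (Suc i) (p (Suc i)))"
      using ap mem by (intro prod.cong) (fastforce simp: jnf_def)+
    also have "\<dots> = (\<Prod>i\<in>{1..n}. M i (p i))"
      using prod.reindex_bij_betw[OF bij, of "\<lambda>i. M i (p i)"] by simp
    finally show "of_int (sign ?q) * (\<Prod>i = 0..<n. jnf n M $$ (i, ?q i)) =
        of_int (sign p) * (\<Prod>i\<in>{1..n}. M i (p i))"
      using sign_map_permutation[of "\<lambda>x. x - 1" "{1..n}" p] p bij' by (simp add: bij_betw_def)
  next
    fix p assume "p \<in> {p. p permutes {0..<n}}"
    then have p: "p permutes {0..<n}" by simp
    show "map_permutation {1..n} (\<lambda>x. x - 1) (map_permutation {0..<n} Suc p) = p"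
      by (rule map_permutation_compose_inv[OF bij p]) auto
    show "map_permutation {0..<n} Suc p \<in> {p. p permutes {1..n}}"
      using map_permutation_permutes[OF bij p] by simp
  qed
  then show ?thesis
    by (simp add: det_def jnf_def)
qed

definition idm :: "nat \<Rightarrow> cmat" where
  "idm n = (\<lambda>i j. if i \<in> {1..n} \<and> j = i then 1 else 0)"

lemma sum_Suc_shift: "(\<Sum>k\<in>{1..n}. f k) = (\<Sum>k = 0..<n. f (Suc k))"
  by (rule sum.reindex_bij_witness[where i = Suc and j = "\<lambda>x. x - 1"]) auto

lemma jnf_mmult: "jnf n (mmult n A B) = jnf n A * jnf n B"
  by (rule eq_matI)
    (auto simp: jnf_def mmult_def scalar_prod_def sum_Suc_shift simp del: One_nat_def)

lemma jnf_idm: "jnf n (idm n) = 1\<^sub>m n"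
  by (rule eq_matI) (auto simp: jnf_def idm_def)

lemma jnf_inject:
  assumes "is_mat n A" "is_mat n B" "jnf n A = jnf n B"
  shows "A = B"
proof (intro ext)
  fix i j
  show "A i j = B i j"
  proof (cases "i \<in> {1..n} \<and> j \<in> {1..n}")
    case True
    then have "jnf n A $$ (i - 1, j - 1) = A i j" "jnf n B $$ (i - 1, j - 1) = B i j"
      by (auto simp: jnf_def)
    with assms(3) show ?thesis by simp
  next
    case False
    with assms(1,2) show ?thesis by (auto simp: is_mat_def)
  qed
qed

lemma is_mat_mmult [simp]: "is_mat n (mmult n A B)"
  by (auto simp: is_mat_def mmult_def)

lemma is_mat_idm [simp]: "is_mat n (idm n)"
  by (auto simp: is_mat_def idm_def)

lemma mdet_mmult: "mdet n (mmult n A B) = mdet n A * mdet n B"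
  by (simp add: mdet_eq_det jnf_mmult det_mult[of _ n])

lemma mdet_idm [simp]: "mdet n (idm n) = 1"
  by (simp add: mdet_eq_det jnf_idm)

lemma mmult_assoc: "mmult n (mmult n A B) C = mmult n A (mmult n B C)"
  by (rule jnf_inject[of n]) (simp_all add: jnf_mmult assoc_mult_mat[of _ n n _ n _ n])

lemma mmult_idm [simp]: "is_mat n A \<Longrightarrow> mmult n (idm n) A = A"
  by (rule jnf_inject[of n]) (simp_all add: jnf_mmult jnf_idm left_mult_one_mat[of _ n n])

lemma mmult_idm_right [simp]: "is_mat n A \<Longrightarrow> mmult n A (idm n) = A"
  by (rule jnf_inject[of n]) (simp_all add: jnf_mmult jnf_idm right_mult_one_mat[of _ n n])

lemma GL_is_mat: "A \<in> GL n \<Longrightarrow> is_mat n A"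
  by (simp add: GL_def)

lemma GL_mmult: "A \<in> GL n \<Longrightarrow> B \<in> GL n \<Longrightarrow> mmult n A B \<in> GL n"
  by (simp add: GL_def mdet_mmult)

lemma GL_idm [simp]: "idm n \<in> GL n"
  by (simp add: GL_def)

lemma GL_I:
  assumes "is_mat n A" "mmult n A B = idm n"
  shows "A \<in> GL n"
proof -
  have "mdet n A * mdet n B = 1"
    using mdet_mmult[of n A B] assms by simp
  with assms show ?thesis by (auto simp: GL_def)
qed

lemma GL_inverse:
  assumes "A \<in> GL n"
  obtains B where "B \<in> GL n" "mmult n A B = idm n" "mmult n B A = idm n"
proof -
  have "det (jnf n A) \<noteq> 0"
    using assms by (simp add: GL_def mdet_eq_det)
  from det_non_zero_imp_unit[OF jnf_carrier this, of "()"]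
  obtain C where C: "C \<in> carrier_mat n n" "C * jnf n A = 1\<^sub>m n" "jnf n A * C = 1\<^sub>m n"
    unfolding Units_def ring_mat_def by auto
  define B :: cmat where
    "B = (\<lambda>i j. if i \<in> {1..n} \<and> j \<in> {1..n} then C $$ (i - 1, j - 1) else 0)"
  have B: "is_mat n B" by (auto simp: is_mat_def B_def)
  have jB: "jnf n B = C"
    using C(1) by (intro eq_matI) (auto simp: jnf_def B_def)
  have 1: "mmult n A B = idm n"
    by (rule jnf_inject[of n]) (simp_all add: jnf_mmult jnf_idm jB C)
  have 2: "mmult n B A = idm n"
    by (rule jnf_inject[of n]) (simp_all add: jnf_mmult jnf_idm jB C)
  from that[OF GL_I[OF B 2] 1 2] show thesis .
qed

lemma mdet_triangular:
  assumes "\<And>i j. j < i \<Longrightarrow> i \<le> n \<Longrightarrow> M i j = 0"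
  shows "mdet n M = (\<Prod>i\<in>{1..n}. M i i)"
proof -
  have "upper_triangular (jnf n M)"
    using assms by (auto simp: upper_triangular_def jnf_def)
  then have "mdet n M = prod_list (diag_mat (jnf n M))"
    by (simp add: mdet_eq_det det_upper_triangular[of _ n])
  also have "\<dots> = (\<Prod>i = 0..<n. M (Suc i) (Suc i))"
    by (simp add: prod_list_diag_prod jnf_def)
  also have "\<dots> = (\<Prod>i\<in>{1..n}. M i i)"
    by (rule prod.reindex_bij_witness[where j = Suc and i = "\<lambda>x. x - 1"]) auto
  finally show ?thesis .
qed

lemma mdet_zero_row:
  assumes "k \<in> {1..n}" "\<And>j. M k j = 0"
  shows "mdet n M = 0"
proof -
  have "(\<Prod>i\<in>{1..n}. M i (p i)) = 0" for p
    by (rule prod_zero) (use assms in \<open>auto intro!: bexI[of _ k]\<close>)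
  then show ?thesis unfolding mdet_def by (intro sum.neutral) auto
qed

lemma mdet_transpose: "mdet n (\<lambda>i j. M j i) = mdet n M"
proof -
  have "jnf n (\<lambda>i j. M j i) = transpose_mat (jnf n M)"
    by (rule eq_matI) (auto simp: jnf_def)
  then show ?thesis
    by (simp add: mdet_eq_det det_transpose[of _ n])
qed

lemma mmult_supp:
  assumes "i \<in> {1..n}" "k \<in> {1..n}" "S \<subseteq> {1..n}"
    and "\<And>l. l \<in> {1..n} - S \<Longrightarrow> A i l * B l k = 0"
  shows "mmult n A B i k = (\<Sum>l\<in>S. A i l * B l k)"
proof -
  have "(\<Sum>l\<in>{1..n}. A i l * B l k) = (\<Sum>l\<in>S. A i l * B l k)"
    by (rule sum.mono_neutral_right) (use assms in auto)
  then show ?thesis using assms by (simp add: mmult_def)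
qed

lemma mmult_zero:
  assumes "\<And>l. l \<in> {1..n} \<Longrightarrow> A i l * B l k = 0"
  shows "mmult n A B i k = 0"
  using assms by (auto simp: mmult_def intro!: sum.neutral)

lemma is_mat_outside: "is_mat n A \<Longrightarrow> i \<notin> {1..n} \<or> j \<notin> {1..n} \<Longrightarrow> A i j = 0"
  by (auto simp: is_mat_def)

lemma is_mat_eqI:
  assumes "is_mat n A" "is_mat n B"
    and "\<And>i j. i \<in> {1..n} \<Longrightarrow> j \<in> {1..n} \<Longrightarrow> A i j = B i j"
  shows "A = B"
  using assms by (intro ext) (metis is_mat_outside)

subsection \<open>Parabolic subgroups with one diagonal block\<close>

text \<open>One family for both kinds of letters: \<open>a = b\<close> gives the Borel subgroup,
  \<open>b = Suc a\<close> the minimal parabolic whose only free subdiagonal entry is (b,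
  a).\<close>

definition parab :: "nat \<Rightarrow> nat \<Rightarrow> nat \<Rightarrow> cmat set" where
  "parab n a b = {M \<in> GL n. \<forall>i k. k < i \<and> \<not> (a \<le> k \<and> i \<le> b) \<longrightarrow> M i k = 0}"

lemma parab_GL: "M \<in> parab n a b \<Longrightarrow> M \<in> GL n"
  by (simp add: parab_def)

lemma parabD: "M \<in> parab n a b \<Longrightarrow> k < i \<Longrightarrow> \<not> (a \<le> k \<and> i \<le> b) \<Longrightarrow> M i k = 0"
  by (simp add: parab_def)

lemma Borel_eq_parab: "Borel n = parab n j j"
  by (auto simp: parab_def Borel_def)

lemma Borel_subset_parab: "Borel n \<subseteq> parab n a b"
  by (auto simp: parab_def Borel_def)

lemma Borel_GL: "M \<in> Borel n \<Longrightarrow> M \<in> GL n"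
  by (simp add: Borel_def)

lemma Borel_minus_GL: "M \<in> Borel_minus n \<Longrightarrow> M \<in> GL n"
  by (simp add: Borel_minus_def)

lemma parab_mmult:
  assumes "M \<in> parab n a b" "N \<in> parab n a b"
  shows "mmult n M N \<in> parab n a b"
proof -
  have "mmult n M N i k = 0" if ki: "k < i" "\<not> (a \<le> k \<and> i \<le> b)" for i k
  proof (rule mmult_zero)
    fix l :: nat
    \<comment> \<open>If both factors could be nonzero, passing from \<open>k\<close> through
      \<open>l\<close> to \<open>i\<close> would go up only inside the block, and then (i, k) itself
      would lie in the block.\<close>
    consider "l < i" "\<not> (a \<le> l \<and> i \<le> b)" | "k < l" "\<not> (a \<le> k \<and> l \<le> b)"
      using ki by linarith
    then show "M i l * N l k = 0"
      by cases (use parabD[OF assms(1)] parabD[OF assms(2)] in auto)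
  qed
  then show ?thesis
    using assms by (simp add: parab_def GL_mmult)
qed

lemma Borel_mmult: "M \<in> Borel n \<Longrightarrow> N \<in> Borel n \<Longrightarrow> mmult n M N \<in> Borel n"
  using parab_mmult[of M n 0 0 N] by (simp add: Borel_eq_parab[of n 0])

lemma Borel_minus_mmult:
  assumes "M \<in> Borel_minus n" "N \<in> Borel_minus n"
  shows "mmult n M N \<in> Borel_minus n"
proof -
  have "mmult n M N i k = 0" if ki: "i < k" for i k
  proof (rule mmult_zero)
    fix l :: nat
    consider "i < l" | "l < k" using ki by linarith
    then show "M i l * N l k = 0"
      by cases (use assms in \<open>auto simp: Borel_minus_def\<close>)
  qed
  then show ?thesis
    using assms by (simp add: Borel_minus_def GL_mmult)
qed

lemma Borel_iff:
  "M \<in> Borel n \<longleftrightarrow> is_mat n M \<and> (\<forall>i j. j < i \<longrightarrow> M i j = 0) \<and> (\<forall>i\<in>{1..n}. M i i \<noteq> 0)"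
  by (auto simp: Borel_def GL_def mdet_triangular)

lemma Borel_diag: "b \<in> Borel n \<Longrightarrow> i \<in> {1..n} \<Longrightarrow> b i i \<noteq> 0"
  by (simp add: Borel_iff)

lemma Borel_minus_iff:
  "M \<in> Borel_minus n \<longleftrightarrow>
    is_mat n M \<and> (\<forall>i j. i < j \<longrightarrow> M i j = 0) \<and> (\<forall>i\<in>{1..n}. M i i \<noteq> 0)"
proof -
  have "mdet n M = (\<Prod>i\<in>{1..n}. M i i)" if "\<forall>i j. i < j \<longrightarrow> M i j = 0"
    using mdet_triangular[of n "\<lambda>i j. M j i"] that mdet_transpose[of n M] by simp
  then show ?thesis
    by (auto simp: Borel_minus_def GL_def)
qed

lemma idm_Borel [simp]: "idm n \<in> Borel n"
  by (simp add: Borel_def) (simp add: idm_def)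

lemma Borel_inverse:
  assumes "M \<in> Borel n"
  obtains N where "N \<in> Borel n" "mmult n M N = idm n" "mmult n N M = idm n"
proof -
  obtain N where N: "N \<in> GL n" "mmult n M N = idm n" "mmult n N M = idm n"
    using GL_inverse[OF Borel_GL[OF assms]] .
  \<comment> \<open>Induction over columns: earlier columns of \<open>N\<close> vanish below the
    diagonal and \<open>M\<close> is upper triangular, so entry (i, j) of the product is the single
    term \<open>N i j * M j j\<close>.\<close>
  have "\<forall>i. j < i \<longrightarrow> N i j = 0" for j
  proof (induction j rule: less_induct)
    case (less j)
    show ?case
    proof (intro allI impI)
      fix i assume "j < i"
      show "N i j = 0"
      proof (cases "i \<in> {1..n} \<and> j \<in> {1..n}")
        case True
        have "N i l * M l j = 0" if "l \<in> {1..n} - {j}" for l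
          using that less.IH[of l] \<open>j < i\<close> assms by (cases "l < j") (auto simp: Borel_iff)
        then have "mmult n N M i j = N i j * M j j"
          using True mmult_supp[of i n j "{j}" N M] by simp
        moreover have "mmult n N M i j = 0"
          using N(3) \<open>j < i\<close> by (simp add: idm_def)
        ultimately show ?thesis
          using assms True by (auto simp: Borel_iff)
      next
        case False
        then show ?thesis
          using N(1) by (metis GL_is_mat is_mat_outside)
      qed
    qed
  qed
  then have "N \<in> Borel n"
    using N(1) by (simp add: Borel_def)
  then show thesis using that N by blast
qed

section \<open>Elementary matrices as row and column operations\<close>

definition elm :: "nat \<Rightarrow> complex \<Rightarrow> nat \<Rightarrow> nat \<Rightarrow> cmat" where
  "elm n a p q = (\<lambda>i k. if i = p \<and> k = q then a else idm n i k)"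

lemma is_mat_elm [simp]: "p \<in> {1..n} \<Longrightarrow> q \<in> {1..n} \<Longrightarrow> is_mat n (elm n a p q)"
  by (auto simp: is_mat_def elm_def idm_def)

lemma elm_mmult:
  assumes "p \<in> {1..n}" "q \<in> {1..n}" "p \<noteq> q" "is_mat n M"
  shows "mmult n (elm n a p q) M = (\<lambda>i k. M i k + (if i = p then a * M q k else 0))"
proof (rule is_mat_eqI[of n])
  show "is_mat n (\<lambda>i k. M i k + (if i = p then a * M q k else 0))"
    using assms by (auto simp: is_mat_def)
next
  fix i k assume ik: "i \<in> {1..n}" "k \<in> {1..n}"
  have "mmult n (elm n a p q) M i k =
      (\<Sum>l\<in>(if i = p then {p, q} else {i}). elm n a p q i l * M l k)"
    by (rule mmult_supp) (use assms ik in \<open>auto simp: elm_def idm_def split: if_splits\<close>)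
  then show "mmult n (elm n a p q) M i k = M i k + (if i = p then a * M q k else 0)"
    using assms ik by (auto simp: elm_def idm_def)
qed simp

lemma mmult_elm:
  assumes "p \<in> {1..n}" "q \<in> {1..n}" "p \<noteq> q" "is_mat n M"
  shows "mmult n M (elm n a p q) = (\<lambda>i k. M i k + (if k = q then a * M i p else 0))"
proof (rule is_mat_eqI[of n])
  show "is_mat n (\<lambda>i k. M i k + (if k = q then a * M i p else 0))"
    using assms by (auto simp: is_mat_def)
next
  fix i k assume ik: "i \<in> {1..n}" "k \<in> {1..n}"
  have "mmult n M (elm n a p q) i k =
      (\<Sum>l\<in>(if k = q then {p, q} else {k}). M i l * elm n a p q l k)"
    by (rule mmult_supp) (use assms ik in \<open>auto simp: elm_def idm_def split: if_splits\<close>)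
  then show "mmult n M (elm n a p q) i k = M i k + (if k = q then a * M i p else 0)"
    using assms ik by (auto simp: elm_def idm_def)
qed simp

lemma elm_inverse:
  assumes "p \<in> {1..n}" "q \<in> {1..n}" "p \<noteq> q"
  shows "mmult n (elm n a p q) (elm n (- a) p q) = idm n"
  using assms by (simp add: elm_mmult) (auto simp: fun_eq_iff elm_def idm_def)

lemma elm_Borel: "p \<in> {1..n} \<Longrightarrow> q \<in> {1..n} \<Longrightarrow> p < q \<Longrightarrow> elm n a p q \<in> Borel n"
  by (simp add: Borel_iff) (auto simp: elm_def idm_def)

lemma elm_Borel_minus:
  "p \<in> {1..n} \<Longrightarrow> q \<in> {1..n} \<Longrightarrow> q < p \<Longrightarrow> elm n a p q \<in> Borel_minus n"
  by (simp add: Borel_minus_iff) (auto simp: elm_def idm_def)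

subsection \<open>Permutation matrices\<close>

abbreviation perm_on :: "nat \<Rightarrow> (nat \<Rightarrow> nat) \<Rightarrow> bool" where
  "perm_on n w \<equiv> bij_betw w {1..n} {1..n}"

lemma is_mat_perm_mat [simp]: "is_mat n (perm_mat n w)"
  by (auto simp: is_mat_def perm_mat_def)

lemma perm_on_mem: "perm_on n w \<Longrightarrow> k \<in> {1..n} \<Longrightarrow> w k \<in> {1..n}"
  by (rule bij_betwE[rule_format])

lemma perm_on_eq_iff:
  "perm_on n w \<Longrightarrow> k \<in> {1..n} \<Longrightarrow> l \<in> {1..n} \<Longrightarrow> w k = w l \<longleftrightarrow> k = l"
  by (metis bij_betw_def inj_onD)

text \<open>Column \<open>k\<close> of \<open>perm_mat n w\<close> is the unit vector at
  \<open>w k\<close>. Hence left multiplication carries row \<open>l\<close> to row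
  \<open>w l\<close>, while right multiplication puts column \<open>w k\<close> into place
  \<open>k\<close>.\<close>

lemma perm_mat_mmult:
  assumes "perm_on n w" "l \<in> {1..n}" "is_mat n M"
  shows "mmult n (perm_mat n w) M (w l) k = M l k"
proof (cases "k \<in> {1..n}")
  case True
  then have "mmult n (perm_mat n w) M (w l) k = (\<Sum>m\<in>{l}. perm_mat n w (w l) m * M m k)"
    using assms perm_on_mem[OF assms(1,2)]
    by (intro mmult_supp) (auto simp: perm_mat_def perm_on_eq_iff simp del: atLeastAtMost_iff)
  then show ?thesis
    using True assms perm_on_mem[OF assms(1,2)] by (simp add: perm_mat_def)
next
  case False
  then show ?thesis using assms by (auto simp: mmult_def is_mat_outside)
qed

lemma mmult_perm_mat:
  assumes "perm_on n w" "k \<in> {1..n}" "is_mat n M"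
  shows "mmult n M (perm_mat n w) i k = M i (w k)"
proof (cases "i \<in> {1..n}")
  case True
  then have "mmult n M (perm_mat n w) i k = (\<Sum>m\<in>{w k}. M i m * perm_mat n w m k)"
    using assms perm_on_mem[OF assms(1,2)]
    by (intro mmult_supp) (auto simp: perm_mat_def perm_on_eq_iff simp del: atLeastAtMost_iff)
  then show ?thesis
    using True assms perm_on_mem[OF assms(1,2)] by (simp add: perm_mat_def)
next
  case False
  then show ?thesis using assms by (auto simp: mmult_def is_mat_outside)
qed

lemma perm_on_cases:
  assumes "perm_on n w" "i \<in> {1..n}"
  obtains l where "l \<in> {1..n}" "i = w l"
  using assms by (metis bij_betw_imp_surj_on imageE)

lemma perm_mat_compose:
  assumes "perm_on n v" "perm_on n w"
  shows "mmult n (perm_mat n v) (perm_mat n w) = perm_mat n (v \<circ> w)"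
proof (rule is_mat_eqI[of n])
  fix i j assume "i \<in> {1..n}" "j \<in> {1..n}"
  then show "mmult n (perm_mat n v) (perm_mat n w) i j = perm_mat n (v \<circ> w) i j"
    using assms perm_on_mem[OF assms(2)] by (simp add: mmult_perm_mat) (simp add: perm_mat_def)
qed simp_all

lemma perm_mat_cong:
  "(\<And>k. k \<in> {1..n} \<Longrightarrow> v k = w k) \<Longrightarrow> perm_mat n v = perm_mat n w"
  by (auto simp: perm_mat_def fun_eq_iff)

lemma perm_mat_id: "perm_mat n (\<lambda>k. k) = idm n"
  by (auto simp: perm_mat_def idm_def fun_eq_iff)

lemma perm_on_perm_inv: "perm_on n w \<Longrightarrow> perm_on n (perm_inv n w)"
  unfolding perm_inv_def by (rule bij_betw_inv_into)

lemma perm_mat_perm_inv: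
  assumes "perm_on n w"
  shows "mmult n (perm_mat n (perm_inv n w)) (perm_mat n w) = idm n"
    and "mmult n (perm_mat n w) (perm_mat n (perm_inv n w)) = idm n"
proof -
  have "perm_inv n w (w k) = k" "w (perm_inv n w k) = k" if "k \<in> {1..n}" for k
    unfolding perm_inv_def
    using assms that by (auto simp: bij_betw_inv_into_left bij_betw_inv_into_right)
  then show "mmult n (perm_mat n (perm_inv n w)) (perm_mat n w) = idm n"
    "mmult n (perm_mat n w) (perm_mat n (perm_inv n w)) = idm n"
    using perm_mat_cong[of n "perm_inv n w \<circ> w" "\<lambda>k. k"]
      perm_mat_cong[of n "w \<circ> perm_inv n w" "\<lambda>k. k"]
    by (simp_all add: perm_mat_compose assms perm_on_perm_inv perm_mat_id del: One_nat_def)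
qed

lemma perm_mat_GL: "perm_on n w \<Longrightarrow> perm_mat n w \<in> GL n"
  using GL_I perm_mat_perm_inv(2) is_mat_perm_mat by blast

text \<open>Conjugation of a root subgroup. The relative order of \<open>w p\<close> and
  \<open>w q\<close> decides whether the factor can be absorbed on the left by an upper or by a
  lower triangular matrix.\<close>

lemma perm_mat_elm:
  assumes "perm_on n w" "p \<in> {1..n}" "q \<in> {1..n}"
  shows "mmult n (perm_mat n w) (elm n a p q) = mmult n (elm n a (w p) (w q)) (perm_mat n w)"
proof (rule is_mat_eqI[of n])
  fix i k assume i: "i \<in> {1..n}" and k: "k \<in> {1..n}"
  obtain l where l: "l \<in> {1..n}" "i = w l" using perm_on_cases[OF assms(1) i] .
  have "mmult n (perm_mat n w) (elm n a p q) i k = elm n a p q l k"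
    unfolding l(2) using assms l by (intro perm_mat_mmult) simp_all
  also have "\<dots> = elm n a (w p) (w q) i (w k)"
    using assms l i k by (simp add: elm_def idm_def perm_on_eq_iff del: atLeastAtMost_iff)
  also have "\<dots> = mmult n (elm n a (w p) (w q)) (perm_mat n w) i k"
    using assms k perm_on_mem by (intro mmult_perm_mat[symmetric] is_mat_elm) blast+
  finally show "mmult n (perm_mat n w) (elm n a p q) i k
      = mmult n (elm n a (w p) (w q)) (perm_mat n w) i k" .
qed simp_all

definition swp :: "nat \<Rightarrow> nat \<Rightarrow> cmat" where
  "swp n j = perm_mat n (Transposition.transpose j (Suc j))"

lemma perm_on_transpose:
  "p \<in> {1..n} \<Longrightarrow> q \<in> {1..n} \<Longrightarrow> perm_on n (Transposition.transpose p q)"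
  by (rule permutes_imp_bij[OF permutes_swap_id])

lemma swp_mmult:
  assumes "1 \<le> j" "Suc j \<le> n" "is_mat n M"
  shows "mmult n (swp n j) M i k = M (Transposition.transpose j (Suc j) i) k"
proof (cases "i \<in> {1..n}")
  case True
  let ?t = "Transposition.transpose j (Suc j)"
  have "mmult n (swp n j) M (?t (?t i)) k = M (?t i) k"
    unfolding swp_def
    using assms True perm_on_mem[OF perm_on_transpose, of j n "Suc j" i]
    by (intro perm_mat_mmult perm_on_transpose) auto
  then show ?thesis by simp
next
  case False
  then have "Transposition.transpose j (Suc j) i = i"
    using assms by (auto simp: Transposition.transpose_def)
  with False show ?thesis
    using is_mat_outside[OF is_mat_mmult] is_mat_outside[OF assms(3)] by metis
qed

lemma mmult_swp:
  assumes "1 \<le> j" "Suc j \<le> n" "is_mat n M"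
  shows "mmult n M (swp n j) i k = M i (Transposition.transpose j (Suc j) k)"
proof (cases "k \<in> {1..n}")
  case True
  then show ?thesis
    unfolding swp_def using assms by (intro mmult_perm_mat perm_on_transpose) auto
next
  case False
  then have "Transposition.transpose j (Suc j) k = k"
    using assms by (auto simp: Transposition.transpose_def)
  with False show ?thesis
    using is_mat_outside[OF is_mat_mmult] is_mat_outside[OF assms(3)] by metis
qed

lemma swp_GL: "1 \<le> j \<Longrightarrow> Suc j \<le> n \<Longrightarrow> swp n j \<in> GL n"
  unfolding swp_def by (intro perm_mat_GL perm_on_transpose) auto

lemma swp_swp: "1 \<le> j \<Longrightarrow> Suc j \<le> n \<Longrightarrow> mmult n (swp n j) (swp n j) = idm n"
  unfolding swp_def
  by (subst perm_mat_compose) (auto intro!: perm_on_transpose simp: perm_mat_id[symmetric] o_def)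

lemma swp_parab: "1 \<le> j \<Longrightarrow> Suc j \<le> n \<Longrightarrow> swp n j \<in> parab n j (Suc j)"
  unfolding parab_def using swp_GL
  by (auto simp: swp_def perm_mat_def Transposition.transpose_def)

lemma elm_parab: "1 \<le> j \<Longrightarrow> Suc j \<le> n \<Longrightarrow> elm n t (Suc j) j \<in> parab n j (Suc j)"
  unfolding parab_def using Borel_minus_GL[OF elm_Borel_minus[of "Suc j" n j t]]
  by (auto simp: elm_def idm_def)

subsection \<open>Parabolic subgroups attached to letters\<close>

fun lidx :: "letter \<Rightarrow> nat" where
  "lidx (R j) = j"
| "lidx (T j) = j"

fun hidx :: "letter \<Rightarrow> nat" where
  "hidx (R j) = j"
| "hidx (T j) = Suc j"

definition valid_letter :: "nat \<Rightarrow> letter \<Rightarrow> bool" where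
  "valid_letter n X \<longleftrightarrow> 1 \<le> lidx X \<and> hidx X \<le> n"

abbreviation lparab :: "nat \<Rightarrow> letter \<Rightarrow> cmat set" where
  "lparab n X \<equiv> parab n (lidx X) (hidx X)"

lemma lidx_le_hidx: "lidx X \<le> hidx X"
  by (cases X) auto

text \<open>Representatives of P/B, the set L of the overview. For \<open>T j\<close> the quotient
  is a projective line: the matrices \<open>elm n t (Suc j) j\<close> cover an affine chart and
  \<open>swp n j\<close> is the point at infinity. The set is closed under inversion.\<close>

fun levi :: "nat \<Rightarrow> letter \<Rightarrow> cmat set" where
  "levi n (R j) = {idm n}"
| "levi n (T j) = insert (swp n j) (range (\<lambda>t. elm n t (Suc j) j))"

lemma levi_subset:
  assumes "valid_letter n X" "r \<in> levi n X"
  shows "r \<in> lparab n X"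
  using assms idm_Borel[of n]
  by (cases X) (auto simp: valid_letter_def swp_parab elm_parab Borel_eq_parab[symmetric])

lemma levi_inverse:
  assumes "valid_letter n X" "r \<in> levi n X"
  obtains s where "s \<in> levi n X" "mmult n r s = idm n" "mmult n s r = idm n"
proof (cases X)
  case (R j)
  then show ?thesis using assms that by simp
next
  case (T j)
  then have j: "1 \<le> j" "Suc j \<le> n" using assms by (auto simp: valid_letter_def)
  from assms(2) T consider "r = swp n j" | t where "r = elm n t (Suc j) j" by auto
  then show ?thesis
  proof cases
    case 1
    then show ?thesis using that[of "swp n j"] T j by (simp add: swp_swp)
  next
    case (2 t)
    then show ?thesis
      using that[of "elm n (- t) (Suc j) j"] T j elm_inverse[of "Suc j" n j t]
        elm_inverse[of "Suc j" n j "- t"] by simp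
  qed
qed

lemma parab_Borel:
  assumes "p \<in> parab n j (Suc j)" "p (Suc j) j = 0"
  shows "p \<in> Borel n"
  using parab_GL[OF assms(1)] parabD[OF assms(1)] assms(2)
  unfolding Borel_def by (auto simp: le_Suc_eq) (metis Suc_leI less_Suc_eq_le order_antisym)

text \<open>Gaussian elimination with pivot \<open>p j j\<close>: one row operation clears the only
  subdiagonal entry.\<close>

lemma parab_elm_decomp:
  assumes "p \<in> parab n j (Suc j)" "1 \<le> j" "Suc j \<le> n" "p j j \<noteq> 0"
  obtains t b where "b \<in> Borel n" "p = mmult n (elm n t (Suc j) j) b"
proof -
  define t where "t = p (Suc j) j / p j j"
  define b where "b = mmult n (elm n (- t) (Suc j) j) p"
  have p: "is_mat n p" using assms(1) by (simp add: parab_GL GL_is_mat)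
  have "b \<in> parab n j (Suc j)"
    unfolding b_def using assms elm_parab by (intro parab_mmult) auto
  moreover have "b (Suc j) j = 0"
    unfolding b_def using assms p by (simp add: elm_mmult t_def)
  ultimately have "b \<in> Borel n" by (rule parab_Borel)
  moreover have "p = mmult n (elm n t (Suc j) j) b"
    using elm_inverse[of "Suc j" n j t] assms p
    by (simp add: b_def mmult_assoc[symmetric])
  ultimately show thesis using that by blast
qed

lemma levi_decomp:
  assumes "valid_letter n X" "p \<in> lparab n X"
  obtains r b where "r \<in> levi n X" "b \<in> Borel n" "p = mmult n r b"
proof (cases X)
  case (R j)
  then have "p \<in> Borel n" using assms by (simp add: Borel_eq_parab[of n j])
  then show thesis using that[of "idm n" p] R by (simp add: Borel_GL GL_is_mat)
next
  case (T j)
  then have j: "1 \<le> j" "Suc j \<le> n" using assms by (auto simp: valid_letter_def)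
  have p: "p \<in> parab n j (Suc j)" using T assms by simp
  show thesis
  proof (cases "p j j = 0")
    case False
    from parab_elm_decomp[OF p j False] that T show thesis by (metis levi.simps(2) insertI2 rangeI)
  next
    case True
    \<comment> \<open>With a zero pivot, swapping rows \<open>j\<close> and \<open>Suc j\<close>
      moves that zero to the subdiagonal position, and the swap is its own inverse.\<close>
    define b where "b = mmult n (swp n j) p"
    have pm: "is_mat n p" using p by (simp add: parab_GL GL_is_mat)
    have "b \<in> parab n j (Suc j)"
      unfolding b_def using p j swp_parab by (intro parab_mmult) auto
    moreover have "b (Suc j) j = 0"
      unfolding b_def using True j pm by (simp add: swp_mmult)
    ultimately have "b \<in> Borel n" by (rule parab_Borel)
    moreover have "p = mmult n (swp n j) b"
      using swp_swp[of j n] j pm by (simp add: b_def mmult_assoc[symmetric])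
    ultimately show thesis using T by (intro that[of "swp n j" b]) simp_all
  qed
qed

lemma lparab_inverse:
  assumes "valid_letter n X" "p \<in> lparab n X"
  obtains q where "q \<in> lparab n X" "mmult n p q = idm n" "mmult n q p = idm n"
proof -
  obtain r b where rb: "r \<in> levi n X" "b \<in> Borel n" "p = mmult n r b"
    using levi_decomp[OF assms] .
  obtain s where s: "s \<in> levi n X" "mmult n r s = idm n" "mmult n s r = idm n"
    using levi_inverse[OF assms(1) rb(1)] .
  obtain c where c: "c \<in> Borel n" "mmult n b c = idm n" "mmult n c b = idm n"
    using Borel_inverse[OF rb(2)] .
  have sm: "is_mat n s" "is_mat n b"
    using s levi_subset assms(1) rb(2) Borel_GL parab_GL GL_is_mat by blast+
  have "mmult n p (mmult n c s) = mmult n r (mmult n (mmult n b c) s)"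
    "mmult n (mmult n c s) p = mmult n c (mmult n (mmult n s r) b)"
    by (simp_all add: rb(3) mmult_assoc)
  then have "mmult n p (mmult n c s) = idm n" "mmult n (mmult n c s) p = idm n"
    by (simp_all add: s c sm)
  moreover have "mmult n c s \<in> lparab n X"
    using c(1) s(1) levi_subset[OF assms(1)] Borel_subset_parab by (intro parab_mmult) blast+
  ultimately show thesis using that by blast
qed

subsection \<open>Inserting and deleting a row and a column\<close>

text \<open>The increasing map that omits \<open>r\<close> (a coface map); \<open>dn r\<close>
  undoes it away from \<open>r\<close>. The cosimplicial identity \<open>up_up\<close> is the source
  of the index shift in the Thompson relations.\<close>

definition up :: "nat \<Rightarrow> nat \<Rightarrow> nat" where
  "up r i = (if i < r then i else Suc i)"

definition dn :: "nat \<Rightarrow> nat \<Rightarrow> nat" where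
  "dn r i = (if i < r then i else i - 1)"

lemma dn_up [simp]: "dn r (up r i) = i"
  by (simp add: up_def dn_def)

lemma up_dn: "i \<noteq> r \<Longrightarrow> up r (dn r i) = i"
  by (auto simp: up_def dn_def)

lemma up_neq [simp]: "up r i \<noteq> r" "r \<noteq> up r i"
  by (auto simp: up_def)

lemma up_inj [simp]: "up r i = up r j \<longleftrightarrow> i = j"
  by (auto simp: up_def)

lemma up_less_iff [simp]: "up r i < up r j \<longleftrightarrow> i < j"
  by (auto simp: up_def)

lemma up_mem: "1 \<le> r \<Longrightarrow> r \<le> Suc n \<Longrightarrow> up r i \<in> {1..Suc n} \<longleftrightarrow> i \<in> {1..n}"
  by (auto simp: up_def)

lemma dn_mem: "1 \<le> r \<Longrightarrow> r \<le> Suc n \<Longrightarrow> i \<noteq> r \<Longrightarrow> dn r i \<in> {1..n} \<longleftrightarrow> i \<in> {1..Suc n}"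
  using up_mem[of r n "dn r i"] up_dn[of i r] by simp

lemma up_cases:
  obtains "i = r" | i' where "i = up r i'"
  using up_dn by metis

lemma sum_up:
  assumes "1 \<le> r" "r \<le> Suc n"
  shows "(\<Sum>k\<in>{1..Suc n}. f k) = f r + (\<Sum>k\<in>{1..n}. f (up r k))"
proof -
  have "(\<Sum>k\<in>{1..Suc n}. f k) = f r + (\<Sum>k\<in>{1..Suc n} - {r}. f k)"
    using assms by (intro sum.remove) auto
  also have "(\<Sum>k\<in>{1..Suc n} - {r}. f k) = (\<Sum>k\<in>{1..n}. f (up r k))"
    using assms up_mem[OF assms] dn_mem[OF assms]
    by (intro sum.reindex_bij_witness[where i = "up r" and j = "dn r"])
      (auto simp: up_dn simp del: atLeastAtMost_iff)
  finally show ?thesis .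
qed

text \<open>The map called phi_j in the overview is \<open>ins j j\<close>. Row and column positions
  are kept separate because \<open>eps j\<close> inserts its unit at row 1 and column
  \<open>j\<close>.\<close>

definition ins :: "nat \<Rightarrow> nat \<Rightarrow> cmat \<Rightarrow> cmat" where
  "ins r c M = (\<lambda>i k. if i = r \<and> k = c then 1 else if i = r \<or> k = c then 0 else M (dn r i) (dn c k))"

definition del :: "nat \<Rightarrow> nat \<Rightarrow> cmat \<Rightarrow> cmat" where
  "del r c M = (\<lambda>i k. M (up r i) (up c k))"

lemma ins_simps [simp]:
  "ins r c M r c = 1"
  "ins r c M r (up c k) = 0"
  "ins r c M (up r i) c = 0"
  "ins r c M (up r i) (up c k) = M i k"
  by (simp_all add: ins_def)

lemma ins_row: "ins r c M r k = (if k = c then 1 else 0)"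
  by (simp add: ins_def)

lemma ins_col: "ins r c M i c = (if i = r then 1 else 0)"
  by (simp add: ins_def)

lemma del_ins [simp]: "del r c (ins r c M) = M"
  by (simp add: del_def)

lemma is_mat_ins:
  assumes "is_mat n M" "r \<in> {1..Suc n}" "c \<in> {1..Suc n}"
  shows "is_mat (Suc n) (ins r c M)"
  unfolding is_mat_def
proof (intro allI impI)
  fix i j assume "i \<notin> {1..Suc n} \<or> j \<notin> {1..Suc n}"
  then show "ins r c M i j = 0"
    using assms dn_mem[of r n i] dn_mem[of c n j] is_mat_outside[OF assms(1), of "dn r i" "dn c j"]
    by (auto simp: ins_def)
qed

lemma is_mat_del:
  assumes "is_mat (Suc n) M" "r \<in> {1..Suc n}" "c \<in> {1..Suc n}"
  shows "is_mat n (del r c M)"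
  unfolding is_mat_def del_def
  using assms up_mem[of r n] up_mem[of c n] is_mat_outside[OF assms(1)]
  by (metis atLeastAtMost_iff)

lemma ext_up:
  assumes "M r c = N r c" "\<And>k. M r (up c k) = N r (up c k)"
    "\<And>i. M (up r i) c = N (up r i) c" "\<And>i k. M (up r i) (up c k) = N (up r i) (up c k)"
  shows "M = (N :: cmat)"
proof (intro ext)
  fix i k
  show "M i k = N i k"
    using assms by (cases rule: up_cases[of i r]; cases rule: up_cases[of k c]) simp_all
qed

lemma ins_del:
  assumes "\<And>k. M r k = (if k = c then 1 else 0)" "\<And>i. M i c = (if i = r then 1 else 0)"
  shows "ins r c (del r c M) = M"
  by (rule ext_up[where r = r and c = c]) (use assms in \<open>simp_all add: del_def\<close>)

lemma mmult_up:
  assumes "s \<in> {1..Suc n}" "i \<in> {1..Suc n}" "k \<in> {1..Suc n}"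
  shows "mmult (Suc n) A B i k = A i s * B s k + (\<Sum>l\<in>{1..n}. A i (up s l) * B (up s l) k)"
  using assms sum_up[of s n "\<lambda>l. A i l * B l k"] by (simp add: mmult_def)

text \<open>The last hypothesis kills every contribution through the middle index \<open>s\<close>,
  so that index can be deleted from both factors.\<close>

lemma del_mmult:
  assumes "r \<in> {1..Suc n}" "s \<in> {1..Suc n}" "c \<in> {1..Suc n}"
    and "\<And>i k. A (up r i) s * B s (up c k) = 0"
  shows "del r c (mmult (Suc n) A B) = mmult n (del r s A) (del s c B)"
proof (rule is_mat_eqI[of n])
  show "is_mat n (del r c (mmult (Suc n) A B))"
    using assms by (intro is_mat_del) auto
next
  fix i k assume "i \<in> {1..n}" "k \<in> {1..n}"
  moreover from this have "up r i \<in> {1..Suc n}" "up c k \<in> {1..Suc n}"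
    using assms up_mem[of r n i] up_mem[of c n k] by auto
  ultimately show "del r c (mmult (Suc n) A B) i k = mmult n (del r s A) (del s c B) i k"
    using assms(2,4) by (simp add: del_def mmult_up[of s]) (simp add: mmult_def)
qed simp

text \<open>Up to the placement of the unit entry, \<open>ins\<close> is the block sum of 1 and the
  given matrix; products multiply blockwise once the middle positions agree.\<close>

lemma mmult_ins:
  assumes "is_mat n A" "is_mat n B" "r \<in> {1..Suc n}" "s \<in> {1..Suc n}" "c \<in> {1..Suc n}"
  shows "mmult (Suc n) (ins r s A) (ins s c B) = ins r c (mmult n A B)"
proof -
  let ?M = "mmult (Suc n) (ins r s A) (ins s c B)"
  have "ins r c (del r c ?M) = ?M"
  proof (rule ins_del)
    show "?M r k = (if k = c then 1 else 0)" for k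
    proof (cases "k \<in> {1..Suc n}")
      case True
      then show ?thesis using assms by (simp add: mmult_up[of s] ins_row)
    next
      case False
      then show ?thesis using assms(5) by (auto simp: mmult_def)
    qed
    show "?M i c = (if i = r then 1 else 0)" for i
    proof (cases "i \<in> {1..Suc n}")
      case True
      then show ?thesis using assms by (simp add: mmult_up[of s] ins_col)
    next
      case False
      then show ?thesis using assms(3) by (auto simp: mmult_def)
    qed
  qed
  moreover have "del r c ?M = mmult n A B"
    using assms by (subst del_mmult[where s = s]) auto
  ultimately show ?thesis by simp
qed

lemma ins_idm: "r \<in> {1..Suc n} \<Longrightarrow> ins r r (idm n) = idm (Suc n)"
  using up_mem[of r n] by (intro ext_up[where r = r and c = r]) (auto simp: idm_def)

lemma ins_GL:
  assumes "M \<in> GL n" "r \<in> {1..Suc n}" "c \<in> {1..Suc n}"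
  shows "ins r c M \<in> GL (Suc n)"
proof -
  obtain N where "N \<in> GL n" "mmult n M N = idm n"
    using GL_inverse[OF assms(1)] by blast
  then show ?thesis
    using assms by (intro GL_I[of _ _ "ins c r N"]) (simp_all add: is_mat_ins mmult_ins ins_idm GL_is_mat)
qed

lemma ins_GL_D:
  assumes "ins r c M \<in> GL (Suc n)" "r \<in> {1..Suc n}" "c \<in> {1..Suc n}"
  shows "M \<in> GL n"
proof -
  obtain N where N: "mmult (Suc n) (ins r c M) N = idm (Suc n)"
    using GL_inverse[OF assms(1)] by blast
  \<comment> \<open>Row \<open>r\<close> and column \<open>c\<close> of the inserted matrix
    contribute nothing off the unit entry, so deletion turns a right inverse of it into a right
    inverse of \<open>M\<close>.\<close>
  have "mmult n M (del c r N) = del r r (mmult (Suc n) (ins r c M) N)"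
    using assms by (subst del_mmult[where s = c]) auto
  also have "\<dots> = del r r (ins r r (idm n))"
    using assms by (simp add: N ins_idm)
  finally have "mmult n M (del c r N) = idm n" by simp
  moreover have "is_mat n M"
    using is_mat_del[of n "ins r c M" r c] assms GL_is_mat by simp
  ultimately show ?thesis using GL_I by blast
qed

lemma ins_Borel:
  assumes "b \<in> Borel n" "r \<in> {1..Suc n}"
  shows "ins r r b \<in> Borel (Suc n)"
proof -
  have "ins r r b i j = 0" if "j < i" for i j
    using that assms by (cases rule: up_cases[of i r]; cases rule: up_cases[of j r]) (auto simp: Borel_def)
  then show ?thesis using assms by (simp add: Borel_def ins_GL)
qed

lemma ins_Borel_minus:
  assumes "b \<in> Borel_minus n" "r \<in> {1..Suc n}"
  shows "ins r r b \<in> Borel_minus (Suc n)"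
proof -
  have "ins r r b i j = 0" if "i < j" for i j
    using that assms by (cases rule: up_cases[of i r]; cases rule: up_cases[of j r]) (auto simp: Borel_minus_def)
  then show ?thesis using assms by (simp add: Borel_minus_def ins_GL)
qed

lemma ins_elm:
  assumes "r \<in> {1..Suc n}"
  shows "ins r r (elm n a p q) = elm (Suc n) a (up r p) (up r q)"
  using assms up_mem[of r n] by (intro ext_up[where r = r and c = r]) (auto simp: elm_def idm_def)

lemma transpose_up:
  "Transposition.transpose (up r a) (up r b) (up r k) = up r (Transposition.transpose a b k)"
  "Transposition.transpose (up r a) (up r b) r = r"
  by (simp_all add: Transposition.transpose_def)

text \<open>The condition \<open>r \<noteq> Suc j\<close> says that the new index does not separate
  the adjacent pair being swapped.\<close>

lemma ins_swp:
  assumes "r \<in> {1..Suc n}" "r \<noteq> Suc j"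
  shows "ins r r (swp n j) = swp (Suc n) (up r j)"
proof -
  have *: "Suc (up r j) = up r (Suc j)"
    using assms by (auto simp: up_def)
  have **: "up r i \<in> {1..Suc n} \<longleftrightarrow> i \<in> {1..n}" for i
    using assms by (intro up_mem) auto
  show ?thesis
    unfolding swp_def *
    using assms **
    by (intro ext_up[where r = r and c = r])
      (auto simp: perm_mat_def transpose_up simp del: atLeastAtMost_iff)
qed

lemma up_up: "j \<le> i \<Longrightarrow> up j (up i k) = up (Suc i) (up j k)"
  by (simp add: up_def)

text \<open>Every index is one of the two inserted positions or comes from an index of
  \<open>h\<close>; on the latter both sides agree by \<open>up_up\<close>.\<close>

lemma ins_ins:
  assumes "j \<le> i"
  shows "ins j j (ins i i h) = ins (Suc i) (Suc i) (ins j j h)"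
proof (intro ext)
  fix a b
  have i: "Suc i = up j i" and j: "j = up (Suc i) j"
    using assms by (simp_all add: up_def)
  have *: "a = Suc i \<or> a = j \<or> (\<exists>k. a = up j (up i k))" for a
    using up_cases[of a j] up_cases[of _ i] i by metis
  consider "a = up j i" | "a = j" | k where "a = up j (up i k)" using * i by metis
  note a = this
  consider "b = up j i" | "b = j" | k where "b = up j (up i k)" using * i by metis
  note b = this
  \<comment> \<open>The evaluation rules of \<open>ins\<close> at position \<open>Suc i\<close>,
    restated for indices written with the outer map \<open>up j\<close>.\<close>
  have r: "ins (Suc i) (Suc i) M (up j i) (up j i) = 1"
    "ins (Suc i) (Suc i) M (up j i) j = 0" "ins (Suc i) (Suc i) M j (up j i) = 0"
    "ins (Suc i) (Suc i) M (up j i) (up j (up i k)) = 0"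
    "ins (Suc i) (Suc i) M (up j (up i k)) (up j i) = 0"
    "ins (Suc i) (Suc i) M j j = M j j"
    "ins (Suc i) (Suc i) M j (up j (up i k)) = M j (up j k)"
    "ins (Suc i) (Suc i) M (up j (up i k)) j = M (up j k) j"
    "ins (Suc i) (Suc i) M (up j (up i k)) (up j (up i l)) = M (up j k) (up j l)" for M k l
    unfolding up_up[OF assms] i[symmetric]
    using ins_simps[of "Suc i" "Suc i" M] j by metis+
  show "ins j j (ins i i h) a b = ins (Suc i) (Suc i) (ins j j h) a b"
    by (rule a; rule b) (simp_all add: r)
qed

subsection \<open>The permutations of a word\<close>

lemma eps_up: "eps r w (up r i) = w i + 1"
  by (simp add: eps_def up_def)

lemma eps_self: "eps r w r = 1"
  by (simp add: eps_def)

text \<open>The value 1 occurs only at \<open>r\<close>, since all other values in range are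
  successors of positive numbers; an injective self-map of a finite set is bijective.\<close>

lemma perm_on_eps:
  assumes "perm_on n w" "r \<in> {1..Suc n}"
  shows "perm_on (Suc n) (eps r w)"
proof -
  have um: "i \<in> {1..n}" if "up r i \<in> {1..Suc n}" for i
    using up_mem[of r n i] assms(2) that by simp
  have w: "w i \<noteq> 0" "w i \<le> n" if "up r i \<in> {1..Suc n}" for i
    using perm_on_mem[OF assms(1) um[OF that]] by auto
  have "inj_on (eps r w) {1..Suc n}"
  proof (rule inj_onI)
    fix x y assume x: "x \<in> {1..Suc n}" and y: "y \<in> {1..Suc n}" and eq: "eps r w x = eps r w y"
    show "x = y"
    proof (cases "x = r \<or> y = r")
      case True
      have "x = r" if x: "eps r w x = 1" "x \<in> {1..Suc n}" for x
      proof (rule up_cases[of x r])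
        fix i assume i: "x = up r i"
        from x(2) have "w i \<noteq> 0" unfolding i by (rule w(1))
        with x(1) show "x = r" unfolding i eps_up by simp
      qed
      then show ?thesis using True x y eq eps_self[of r w] by metis
    next
      case False
      then obtain i k where "x = up r i" "y = up r k"
        using up_cases[of x r] up_cases[of y r] by metis
      then show ?thesis
        using eq perm_on_eq_iff[OF assms(1) um um, of i k] x y by (simp add: eps_up)
    qed
  qed
  moreover have "eps r w x \<in> {1..Suc n}" if "x \<in> {1..Suc n}" for x
  proof (cases "x = r")
    case True
    then show ?thesis by (simp add: eps_self)
  next
    case False
    then obtain i where "x = up r i" using up_cases[of x r] by metis
    then show ?thesis using w[of i] that by (simp add: eps_up)
  qed
  ultimately show ?thesis
    unfolding bij_betw_def by (metis endo_inj_surj finite_atLeastAtMost image_subsetI)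
qed

text \<open>This turns the combinatorial recursion for u and v into matrix insertion.\<close>

lemma perm_mat_eps:
  assumes "perm_on n w" "r \<in> {1..Suc n}"
  shows "perm_mat (Suc n) (eps r w) = ins 1 r (perm_mat n w)"
proof (rule ext_up[where r = 1 and c = r])
  show "perm_mat (Suc n) (eps r w) (up 1 i) (up r k) = ins 1 r (perm_mat n w) (up 1 i) (up r k)" for i k
    using assms up_mem[of r n] up_mem[of 1 n] by (simp add: perm_mat_def eps_up) (simp add: up_def)
  show "perm_mat (Suc n) (eps r w) 1 (up r k) = ins 1 r (perm_mat n w) 1 (up r k)" for k
    using assms up_mem[of r n k] perm_on_mem[OF assms(1), of k] by (auto simp: perm_mat_def eps_up)
  show "perm_mat (Suc n) (eps r w) (up 1 i) r = ins 1 r (perm_mat n w) (up 1 i) r" for i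
    by (simp add: perm_mat_def eps_self)
qed (use assms in \<open>auto simp: perm_mat_def eps_self\<close>)

subsection \<open>Continuity\<close>

lemma continuous_on_cmatI:
  fixes f :: "'a::topological_space \<Rightarrow> cmat"
  assumes "\<And>i j. continuous_on S (\<lambda>x. f x i j)"
  shows "continuous_on S f"
  by (intro continuous_on_coordinatewise_then_product assms)

lemma continuous_on_entry: "continuous_on UNIV (\<lambda>M :: cmat. M i j)"
  by (rule continuous_on_product_then_coordinatewise) simp

lemma continuous_on_mdet: "continuous_on UNIV (mdet n)"
  unfolding mdet_def by (intro continuous_intros continuous_on_entry)

lemma continuous_on_mmult_left: "continuous_on UNIV (\<lambda>M. mmult n A M)"
  unfolding mmult_def
proof (intro continuous_on_cmatI)
  fix i k
  show "continuous_on UNIV (\<lambda>M. if i \<in> {1..n} \<and> k \<in> {1..n} then \<Sum>l\<in>{1..n}. A i l * M l k else 0)"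
    by (cases "i \<in> {1..n} \<and> k \<in> {1..n}") (auto intro!: continuous_intros continuous_on_entry)
qed

lemma continuous_on_mmult_right: "continuous_on UNIV (\<lambda>M. mmult n M A)"
  unfolding mmult_def
proof (intro continuous_on_cmatI)
  fix i k
  show "continuous_on UNIV (\<lambda>M. if i \<in> {1..n} \<and> k \<in> {1..n} then \<Sum>l\<in>{1..n}. M i l * A l k else 0)"
    by (cases "i \<in> {1..n} \<and> k \<in> {1..n}") (auto intro!: continuous_intros continuous_on_entry)
qed

lemma continuous_on_del: "continuous_on UNIV (del r c)"
  unfolding del_def by (intro continuous_on_cmatI continuous_on_entry)

lemma continuous_on_ins: "continuous_on UNIV (ins r c)"
  unfolding ins_def
proof (intro continuous_on_cmatI)
  fix i k
  show "continuous_on UNIV (\<lambda>M :: cmat. if i = r \<and> k = c then 1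
      else if i = r \<or> k = c then 0 else M (dn r i) (dn c k))"
    by (cases "i = r"; cases "k = c") (simp_all add: continuous_on_entry)
qed

lemma closure_map:
  assumes "continuous_on UNIV f" "x \<in> closure S" "\<And>y. y \<in> S \<Longrightarrow> f y \<in> closure S'"
  shows "f x \<in> closure S'"
proof -
  have "f ` closure S \<subseteq> closure S'"
    by (intro image_closure_subset continuous_on_subset[OF assms(1)]) (use assms(3) in auto)
  then show ?thesis using assms(2) by blast
qed

text \<open>Nonvanishing of the determinant is an open condition, so near \<open>x\<close> only
  those points of \<open>S\<close> matter whose images are invertible.\<close>

lemma closure_map_GL:
  assumes "continuous_on UNIV f" "x \<in> closure S" "f x \<in> GL n"
    and "\<And>y. y \<in> S \<Longrightarrow> mdet n (f y) \<noteq> 0 \<Longrightarrow> f y \<in> S'"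
  shows "f x \<in> closure S'"
proof -
  have "open {y. mdet n (f y) \<noteq> 0}"
    by (intro open_Collect_neq continuous_on_compose2[OF continuous_on_mdet assms(1)])
      (auto intro: continuous_intros)
  then have "{y. mdet n (f y) \<noteq> 0} \<inter> closure S \<subseteq> closure ({y. mdet n (f y) \<noteq> 0} \<inter> S)"
    by (rule open_Int_closure_subset)
  moreover have "x \<in> {y. mdet n (f y) \<noteq> 0} \<inter> closure S"
    using assms(2,3) by (simp add: GL_def)
  ultimately have "x \<in> closure ({y. mdet n (f y) \<noteq> 0} \<inter> S)" by (rule subsetD)
  then show ?thesis
    by (rule closure_map[OF assms(1)]) (use assms(4) closure_subset in auto)
qed

lemma closure_zero:
  fixes f :: "cmat \<Rightarrow> complex"
  assumes "continuous_on UNIV f" "x \<in> closure S" "\<And>y. y \<in> S \<Longrightarrow> f y = 0"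
  shows "f x = 0"
proof -
  have "f x \<in> closure {0}"
    by (rule closure_map[OF assms(1,2)]) (use assms(3) in simp)
  then show ?thesis by simp
qed

subsection \<open>The quotient topology\<close>

lemma coset_self: "g \<in> GL n \<Longrightarrow> g \<in> coset n g"
  unfolding coset_def by (rule image_eqI[of _ _ "idm n"]) (simp_all add: GL_is_mat)

lemma coset_subset_GL: "g \<in> GL n \<Longrightarrow> coset n g \<subseteq> GL n"
  by (auto simp: coset_def GL_mmult Borel_GL)

lemma coset_eq:
  assumes "g \<in> GL n" "h \<in> coset n g"
  shows "coset n h = coset n g"
proof -
  obtain b where b: "b \<in> Borel n" "h = mmult n g b"
    using assms(2) by (auto simp: coset_def)
  obtain c where c: "c \<in> Borel n" "mmult n b c = idm n"
    using Borel_inverse[OF b(1)] by blast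
  show ?thesis
  proof
    show "coset n h \<subseteq> coset n g"
      using b Borel_mmult by (auto simp: coset_def mmult_assoc)
    show "coset n g \<subseteq> coset n h"
    proof
      fix x assume "x \<in> coset n g"
      then obtain d where d: "d \<in> Borel n" "x = mmult n g d" by (auto simp: coset_def)
      have "x = mmult n g (mmult n (mmult n b c) d)"
        using d c by (simp add: Borel_GL GL_is_mat)
      then have "x = mmult n h (mmult n c d)"
        by (simp add: b(2) mmult_assoc)
      then show "x \<in> coset n h"
        using Borel_mmult[OF c(1) d(1)] by (auto simp: coset_def)
    qed
  qed
qed

lemma Fl_coset: "C \<in> Fl n \<Longrightarrow> x \<in> C \<Longrightarrow> x \<in> GL n \<and> C = coset n x"
  using coset_eq coset_subset_GL by (fastforce simp: Fl_def)

lemma Fl_nonempty: "C \<in> Fl n \<Longrightarrow> \<exists>x. x \<in> C"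
  using coset_self by (auto simp: Fl_def)

text \<open>Cosets are nonempty and equal as soon as they share a point, so a set of flags is
  determined by its preimage in \<open>GL\<close>. All varieties can therefore be studied as subsets
  of \<open>GL\<close>.\<close>

lemma Fl_Union_eqD:
  assumes "A \<subseteq> Fl n" "B \<subseteq> Fl n" "\<Union>A = \<Union>B"
  shows "A = B"
proof -
  have "C \<in> B" if AB: "A \<subseteq> Fl n" "B \<subseteq> Fl n" "\<Union>A = \<Union>B" "C \<in> A" for A B C
  proof -
    have C: "C \<in> Fl n" using AB by blast
    obtain x where x: "x \<in> C" using Fl_nonempty[OF C] by blast
    then obtain D where D: "D \<in> B" "x \<in> D" using AB by blast
    then have "D \<in> Fl n" using AB by blast
    then have "C = D" using Fl_coset[OF C x] Fl_coset[OF _ D(2)] by metis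
    then show ?thesis using D by simp
  qed
  from this[OF assms] this[OF assms(2,1) assms(3)[symmetric]] show ?thesis
    by (intro equalityI subsetI)
qed

lemma Union_Int_Fl:
  assumes "A \<subseteq> Fl n" "B \<subseteq> Fl n"
  shows "\<Union>(A \<inter> B) = \<Union>A \<inter> \<Union>B"
proof
  show "\<Union>A \<inter> \<Union>B \<subseteq> \<Union>(A \<inter> B)"
  proof
    fix x assume "x \<in> \<Union>A \<inter> \<Union>B"
    then obtain C D where "C \<in> A" "D \<in> B" "x \<in> C" "x \<in> D" by blast
    then show "x \<in> \<Union>(A \<inter> B)"
      using Fl_coset[of C n x] Fl_coset[of D n x] assms by auto
  qed
qed auto

lemma openin_Fl_top:
  "openin (Fl_top n) U \<longleftrightarrow> U \<subseteq> Fl n \<and> openin (top_of_set (GL n)) (\<Union>U)"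
proof -
  have "istopology (\<lambda>U. U \<subseteq> Fl n \<and> openin (top_of_set (GL n)) (\<Union>U))"
    unfolding istopology_def
  proof (rule conjI; intro allI impI)
    fix U V
    assume "U \<subseteq> Fl n \<and> openin (top_of_set (GL n)) (\<Union>U)"
      and "V \<subseteq> Fl n \<and> openin (top_of_set (GL n)) (\<Union>V)"
    then show "U \<inter> V \<subseteq> Fl n \<and> openin (top_of_set (GL n)) (\<Union>(U \<inter> V))"
      by (auto simp: Union_Int_Fl[of U n V] intro: openin_Int)
  next
    fix K :: "cmat set set set"
    assume *: "\<forall>U\<in>K. U \<subseteq> Fl n \<and> openin (top_of_set (GL n)) (\<Union>U)"
    have "openin (top_of_set (GL n)) (\<Union>(Union ` K))"
      using * by (intro openin_Union) auto
    moreover have "\<Union>(\<Union>K) = \<Union>(Union ` K)" by blast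
    ultimately show "\<Union>K \<subseteq> Fl n \<and> openin (top_of_set (GL n)) (\<Union>(\<Union>K))"
      using * by auto
  qed
  then show ?thesis
    unfolding Fl_top_def by (simp add: topology_inverse')
qed

lemma Union_Fl: "\<Union>(Fl n) = GL n"
  using coset_self coset_subset_GL unfolding Fl_def by blast

lemma topspace_Fl_top: "topspace (Fl_top n) = Fl n"
proof
  show "topspace (Fl_top n) \<subseteq> Fl n"
    by (auto simp: topspace_def openin_Fl_top)
  have "openin (Fl_top n) (Fl n)"
    by (simp add: openin_Fl_top Union_Fl)
  then show "Fl n \<subseteq> topspace (Fl_top n)" by (rule openin_subset)
qed

lemma closure_mmult_right:
  assumes "x \<in> closure S" "\<And>y. y \<in> S \<Longrightarrow> mmult n y a \<in> S'"
  shows "mmult n x a \<in> closure S'"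
  by (rule closure_map[OF continuous_on_mmult_right assms(1)]) (use assms(2) closure_subset in auto)

text \<open>Closure commutes with taking preimages under the quotient map: the closure of a union of
  cosets is stable under right multiplication by the Borel subgroup, so its complement in
  \<open>GL n\<close> is again a union of cosets.\<close>

lemma Union_Fl_closure_of:
  assumes S: "S \<subseteq> Fl n"
  shows "\<Union>(Fl_top n closure_of S) = closure (\<Union>S) \<inter> GL n"
proof (intro equalityI subsetI)
  fix x assume "x \<in> \<Union>(Fl_top n closure_of S)"
  then obtain C where C: "x \<in> C" "C \<in> Fl_top n closure_of S" by blast
  then have "C \<in> Fl n"
    using closure_of_subset_topspace[of "Fl_top n" S] unfolding topspace_Fl_top by blast
  from Fl_coset[OF this C(1)] have x: "x \<in> GL n" "C = coset n x" by auto
  define V where "V = GL n - closure (\<Union>S)"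
  have V: "coset n y \<subseteq> V" if y: "y \<in> V" for y
  proof
    fix z assume z: "z \<in> coset n y"
    have yG: "y \<in> GL n" using y by (simp add: V_def)
    have "y \<in> coset n z" using coset_eq[OF yG z] coset_self[OF yG] by simp
    then obtain b where b: "b \<in> Borel n" "y = mmult n z b" by (auto simp: coset_def)
    have inv: "mmult n s b \<in> \<Union>S" if "s \<in> \<Union>S" for s
    proof -
      obtain D where D: "D \<in> S" "s \<in> D" using \<open>s \<in> \<Union>S\<close> by blast
      then have "D = coset n s" using S Fl_coset[of D n s] by auto
      then have "mmult n s b \<in> D" using b(1) unfolding coset_def by blast
      then show ?thesis using D(1) by blast
    qed
    \<comment> \<open>Since \<open>y\<close> is \<open>z\<close> times an element of the Borel
      subgroup and right multiplication is continuous, \<open>z\<close> cannot lie in the closure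
      without \<open>y\<close>.\<close>
    have "y \<in> closure (\<Union>S)" if "z \<in> closure (\<Union>S)"
      using closure_mmult_right[OF that inv] b(2) by simp
    moreover have "z \<in> GL n" using z coset_subset_GL[OF yG] by blast
    ultimately show "z \<in> V"
      using y unfolding V_def by blast
  qed
  have "openin (top_of_set (GL n)) V"
    unfolding V_def Diff_eq by (intro openin_open_Int open_Compl closed_closure)
  moreover have VGL: "V \<subseteq> GL n" by (auto simp: V_def)
  moreover have "\<Union>(coset n ` V) = V"
    using V coset_self VGL by fast
  ultimately have "openin (Fl_top n) (coset n ` V)"
    unfolding openin_Fl_top Fl_def by (simp add: image_mono)
  moreover have "y \<notin> coset n ` V" if "y \<in> S" for y
  proof
    assume "y \<in> coset n ` V"
    then obtain z where z: "z \<in> V" "y = coset n z" by blast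
    have "z \<in> y" using coset_self[of z n] z VGL by auto
    then have "z \<in> \<Union>S" using that by (rule UnionI[rotated])
    then have "z \<in> closure (\<Union>S)" by (rule subsetD[OF closure_subset])
    then show False using z(1) by (simp add: V_def)
  qed
  ultimately have "C \<notin> coset n ` V"
    using C(2) unfolding in_closure_of by metis
  then have "x \<notin> V" using x(2) imageI[of x V "coset n"] by metis
  then show "x \<in> closure (\<Union>S) \<inter> GL n"
    using x(1) by (simp add: V_def)
next
  fix x assume x: "x \<in> closure (\<Union>S) \<inter> GL n"
  then have xC: "x \<in> coset n x" by (intro coset_self) simp
  have "\<exists>D. D \<in> S \<and> D \<in> U" if U: "coset n x \<in> U" "openin (Fl_top n) U" for U
  proof -
    \<comment> \<open>Conversely, an open set of flags has a relatively open preimage, which meets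
      the preimage of \<open>S\<close> near \<open>x\<close>; the coset of a common point lies in
      both sets.\<close>
    obtain W where W: "open W" "\<Union>U = GL n \<inter> W"
      using U(2) by (auto simp: openin_Fl_top openin_open)
    then have "x \<in> W" using U(1) xC by blast
    then have "W \<inter> \<Union>S \<noteq> {}"
      using x W(1) open_Int_closure_eq_empty[of W "\<Union>S"] by blast
    then obtain y D where y: "y \<in> W" "y \<in> D" "D \<in> S" by blast
    then have yD: "y \<in> GL n" "D = coset n y" using S Fl_coset[of D n y] by auto
    then obtain E where E: "y \<in> E" "E \<in> U" using y W(2) by blast
    then have "E \<in> Fl n" using U(2) unfolding openin_Fl_top by blast
    then have "E = D" using E(1) yD(2) Fl_coset by metis
    then show ?thesis using y E by blast
  qed
  moreover have "coset n x \<in> Fl n" using x by (simp add: Fl_def)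
  ultimately have "coset n x \<in> Fl_top n closure_of S"
    unfolding in_closure_of topspace_Fl_top by simp
  then show "x \<in> \<Union>(Fl_top n closure_of S)"
    using xC by (rule UnionI)
qed

subsection \<open>Schubert varieties as closures of double cosets\<close>

text \<open>The double coset A w Q. With \<open>Q\<close> the Borel subgroup it is the preimage of a
  Schubert cell; leaving \<open>Q\<close> free allows it to be enlarged to a parabolic.\<close>

definition dcos :: "nat \<Rightarrow> cmat set \<Rightarrow> (nat \<Rightarrow> nat) \<Rightarrow> cmat set \<Rightarrow> cmat set" where
  "dcos n A w Q = {mmult n (mmult n b (perm_mat n w)) q | b q. b \<in> A \<and> q \<in> Q}"

lemma Union_schubert:
  assumes "perm_on n w" "A \<subseteq> GL n"
  shows "\<Union>(Fl_top n closure_of {coset n (mmult n b (perm_mat n w)) | b. b \<in> A})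
    = closure (dcos n A w (Borel n)) \<inter> GL n"
proof -
  have "{coset n (mmult n b (perm_mat n w)) | b. b \<in> A} \<subseteq> Fl n"
  proof
    fix C assume "C \<in> {coset n (mmult n b (perm_mat n w)) | b. b \<in> A}"
    then obtain b where "b \<in> A" "C = coset n (mmult n b (perm_mat n w))" by blast
    then show "C \<in> Fl n"
      using GL_mmult[OF _ perm_mat_GL[OF assms(1)]] assms(2) unfolding Fl_def by blast
  qed
  moreover have "\<Union>{coset n (mmult n b (perm_mat n w)) | b. b \<in> A} = dcos n A w (Borel n)"
    unfolding coset_def dcos_def by blast
  ultimately show ?thesis by (simp add: Union_Fl_closure_of)
qed

lemma Union_richardson:
  assumes "perm_on n v" "perm_on n u"
  shows "\<Union>(richardson n v u) = closure (dcos n (Borel n) v (Borel n))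
    \<inter> closure (dcos n (Borel_minus n) u (Borel n)) \<inter> GL n"
proof -
  have "Fl_top n closure_of A \<subseteq> Fl n" for A
    using closure_of_subset_topspace[of "Fl_top n" A] by (simp add: topspace_Fl_top)
  then have "\<Union>(richardson n v u) = \<Union>(schubert_upper n v) \<inter> \<Union>(schubert_lower n u)"
    unfolding richardson_def schubert_upper_def schubert_lower_def by (intro Union_Int_Fl[of _ n])
  moreover have "Borel n \<subseteq> GL n" "Borel_minus n \<subseteq> GL n"
    by (auto simp: Borel_GL Borel_minus_GL)
  ultimately show ?thesis
    unfolding schubert_upper_def schubert_lower_def
    using Union_schubert[OF assms(1)] Union_schubert[OF assms(2)] by (simp add: Int_ac)
qed

lemma richardson_subset_Fl: "richardson n v u \<subseteq> Fl n"
  unfolding richardson_def schubert_upper_def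
  using closure_of_subset_topspace[of "Fl_top n"] unfolding topspace_Fl_top by (rule le_infI1)

section \<open>Stability of Schubert closures under a minimal parabolic\<close>

lemma parab_row:
  assumes p: "p \<in> parab n j (Suc j)" and j: "1 \<le> j" "Suc j \<le> n"
    and i: "i \<in> {j, Suc j}" "p i j = 0"
  shows "p i (Suc j) \<noteq> 0"
proof (cases "i = j")
  case True
  \<comment> \<open>After exchanging the two rows the zero sits in the subdiagonal position, so the
    matrix is upper triangular with nonzero diagonal.\<close>
  let ?q = "mmult n (swp n j) p"
  have q: "?q a k = p (Transposition.transpose j (Suc j) a) k" for a k
    using p j by (intro swp_mmult GL_is_mat parab_GL)
  have "?q \<in> parab n j (Suc j)"
    using p j by (intro parab_mmult swp_parab)
  moreover have "?q (Suc j) j = 0"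
    using i(2) True unfolding q by simp
  ultimately have "?q \<in> Borel n" by (rule parab_Borel)
  then have "?q (Suc j) (Suc j) \<noteq> 0"
    by (rule Borel_diag) (use j in simp)
  then show ?thesis using True unfolding q by simp
next
  case False
  then have i': "i = Suc j" using i(1) by simp
  then have "p \<in> Borel n" using parab_Borel[OF p] i(2) by simp
  then show ?thesis unfolding i' by (rule Borel_diag) (use j in simp)
qed

text \<open>Either entry of column \<open>j\<close> of the block can be made nonzero by an
  arbitrarily small column operation, because its neighbour in the same row is nonzero when it
  vanishes.\<close>

lemma parab_dense:
  assumes p: "p \<in> parab n j (Suc j)" and j: "1 \<le> j" "Suc j \<le> n" and i: "i \<in> {j, Suc j}"
  shows "p \<in> closure {q \<in> parab n j (Suc j). q i j \<noteq> 0}" (is "_ \<in> closure ?Q")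
proof (cases "p i j = 0")
  case False
  with p have "p \<in> ?Q" by simp
  then show ?thesis by (rule subsetD[OF closure_subset])
next
  case True
  \<comment> \<open>A line through \<open>p\<close> inside the parabolic: column
    \<open>Suc j\<close> is added \<open>t\<close> times to column \<open>j\<close>, and
    \<open>t\<close> tends to 0.\<close>
  define f where "f = (\<lambda>t. mmult n p (elm n t (Suc j) j))"
  have f: "f t = (\<lambda>a k. p a k + (if k = j then t * p a (Suc j) else 0))" for t
    unfolding f_def using j by (intro mmult_elm GL_is_mat parab_GL[OF p]) simp_all
  have "f 0 \<in> closure ?Q"
  proof (rule closure_map)
    show "continuous_on UNIV f"
    proof (intro continuous_on_cmatI)
      fix a k show "continuous_on UNIV (\<lambda>t. f t a k)"
        unfolding f by (cases "k = j") (simp_all add: continuous_intros)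
    qed
    show "0 \<in> closure (- {0 :: complex})"
      unfolding closure_complement by simp
    fix t :: complex assume "t \<in> - {0}"
    then have "f t i j \<noteq> 0"
      unfolding f using True parab_row[OF p j i True] by simp
    moreover have "f t \<in> parab n j (Suc j)"
      unfolding f_def using j by (intro parab_mmult p elm_parab)
    ultimately have "f t \<in> ?Q" by simp
    then show "f t \<in> closure ?Q" by (rule subsetD[OF closure_subset])
  qed
  moreover have "f 0 = p" unfolding f by (intro ext) simp
  ultimately show ?thesis by simp
qed

text \<open>The open Bruhat cell of the parabolic: with pivot \<open>p (Suc j) j\<close> a row
  operation clears entry (j, j), after which the swap yields an upper triangular matrix.\<close>

lemma parab_swp_decomp:
  assumes p: "p \<in> parab n j (Suc j)" and j: "1 \<le> j" "Suc j \<le> n" and nz: "p (Suc j) j \<noteq> 0"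
  obtains c b where "b \<in> Borel n" "p = mmult n (elm n c j (Suc j)) (mmult n (swp n j) b)"
proof -
  define c where "c = p j j / p (Suc j) j"
  define e where "e = mmult n (elm n (- c) j (Suc j)) p"
  define b where "b = mmult n (swp n j) e"
  have pm: "is_mat n p" by (intro GL_is_mat parab_GL[OF p])
  have em: "is_mat n e" by (simp add: e_def)
  have j': "j \<in> {1..n}" "Suc j \<in> {1..n}" "j \<noteq> Suc j" "j < Suc j" using j by auto
  have "elm n (- c) j (Suc j) \<in> parab n j (Suc j)"
    using elm_Borel[OF j'(1,2,4)] Borel_subset_parab by (rule subsetD[rotated])
  then have "e \<in> parab n j (Suc j)"
    unfolding e_def using p by (rule parab_mmult)
  then have "b \<in> parab n j (Suc j)"
    unfolding b_def using j by (intro parab_mmult swp_parab)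
  moreover have "b (Suc j) j = e j j"
    unfolding b_def swp_mmult[OF j em] by simp
  moreover have "e j j = 0"
    unfolding e_def elm_mmult[OF j'(1-3) pm] using nz by (simp add: c_def)
  ultimately have "b \<in> Borel n" by (intro parab_Borel) simp_all
  moreover have "mmult n (elm n c j (Suc j)) (mmult n (swp n j) b) = p"
    unfolding b_def mmult_assoc[of n "swp n j", symmetric] swp_swp[OF j] mmult_idm[OF em]
    unfolding e_def mmult_assoc[symmetric] elm_inverse[OF j'(1-3)] mmult_idm[OF pm] ..
  ultimately show thesis using that[of b c] by simp
qed

lemma dcosI: "b \<in> A \<Longrightarrow> q \<in> Q \<Longrightarrow> mmult n (mmult n b (perm_mat n w)) q \<in> dcos n A w Q"
  unfolding dcos_def by blast

lemma dcosE:
  assumes "x \<in> dcos n A w Q"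
  obtains b q where "b \<in> A" "q \<in> Q" "x = mmult n (mmult n b (perm_mat n w)) q"
  using assms unfolding dcos_def by blast

text \<open>For the closure it suffices to reach the dense part of the parabolic where
  \<open>q i j\<close> is nonzero, since left multiplication is continuous.\<close>

lemma closure_dcos_parab:
  assumes "1 \<le> j" "Suc j \<le> n" "i \<in> {j, Suc j}"
    and S: "\<And>b q. b \<in> A \<Longrightarrow> q \<in> parab n j (Suc j) \<Longrightarrow> q i j \<noteq> 0 \<Longrightarrow>
      mmult n (mmult n b (perm_mat n w)) q \<in> S"
    and sub: "S \<subseteq> dcos n A w (parab n j (Suc j))"
  shows "closure S = closure (dcos n A w (parab n j (Suc j)))"
proof
  show "closure S \<subseteq> closure (dcos n A w (parab n j (Suc j)))"
    by (rule closure_mono[OF sub])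
  show "closure (dcos n A w (parab n j (Suc j))) \<subseteq> closure S"
  proof (intro closure_minimal subsetI closed_closure)
    fix x assume "x \<in> dcos n A w (parab n j (Suc j))"
    then obtain b q where b: "b \<in> A" and q: "q \<in> parab n j (Suc j)"
      and x: "x = mmult n (mmult n b (perm_mat n w)) q" by (rule dcosE)
    show "x \<in> closure S"
      unfolding x
    proof (rule closure_map[OF continuous_on_mmult_left parab_dense[OF q assms(1-3)]])
      fix y assume "y \<in> {q \<in> parab n j (Suc j). q i j \<noteq> 0}"
      then show "mmult n (mmult n b (perm_mat n w)) y \<in> closure S"
        by (intro subsetD[OF closure_subset] S b) simp_all
    qed
  qed
qed

text \<open>On the open cell, the factor \<open>elm n c j (Suc j)\<close> crosses \<open>w\<close>
  and becomes upper triangular because \<open>w j < w (Suc j)\<close>. Hence B w s B is dense in B w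
  P.\<close>

lemma closure_dcos_upper:
  assumes w: "perm_on n w" and j: "1 \<le> j" "Suc j \<le> n" and less: "w j < w (Suc j)"
  shows "closure (dcos n (Borel n) (w \<circ> Transposition.transpose j (Suc j)) (Borel n))
    = closure (dcos n (Borel n) w (parab n j (Suc j)))"
proof (rule closure_dcos_parab[where i = "Suc j"])
  let ?t = "Transposition.transpose j (Suc j)"
  have j': "j \<in> {1..n}" "Suc j \<in> {1..n}" using j by auto
  have ws: "perm_mat n (w \<circ> ?t) = mmult n (perm_mat n w) (swp n j)"
    unfolding swp_def by (intro perm_mat_compose[symmetric] w perm_on_transpose j')
  show "dcos n (Borel n) (w \<circ> ?t) (Borel n) \<subseteq> dcos n (Borel n) w (parab n j (Suc j))"
  proof
    fix x assume "x \<in> dcos n (Borel n) (w \<circ> ?t) (Borel n)"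
    then obtain b q where b: "b \<in> Borel n" and q: "q \<in> Borel n"
      and x: "x = mmult n (mmult n b (perm_mat n (w \<circ> ?t))) q" by (rule dcosE)
    have "mmult n (swp n j) q \<in> parab n j (Suc j)"
      using q Borel_subset_parab by (intro parab_mmult swp_parab j) blast
    from dcosI[OF b this, where w = w and n = n] show "x \<in> dcos n (Borel n) w (parab n j (Suc j))"
      by (simp add: x ws mmult_assoc)
  qed
  fix b q assume b: "b \<in> Borel n" and q: "q \<in> parab n j (Suc j)" "q (Suc j) j \<noteq> 0"
  obtain c d where d: "d \<in> Borel n"
    and qd: "q = mmult n (elm n c j (Suc j)) (mmult n (swp n j) d)"
    using parab_swp_decomp[OF q(1) j q(2)] .
  let ?e = "elm n c (w j) (w (Suc j))"
  have "mmult n (mmult n b (perm_mat n w)) q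
      = mmult n b (mmult n (mmult n (perm_mat n w) (elm n c j (Suc j))) (mmult n (swp n j) d))"
    by (simp add: qd mmult_assoc)
  also have "mmult n (perm_mat n w) (elm n c j (Suc j)) = mmult n ?e (perm_mat n w)"
    by (intro perm_mat_elm w j')
  finally have *: "mmult n (mmult n b (perm_mat n w)) q
      = mmult n (mmult n (mmult n b ?e) (perm_mat n (w \<circ> ?t))) d"
    by (simp add: ws mmult_assoc)
  have "mmult n b ?e \<in> Borel n"
    by (intro Borel_mmult elm_Borel b less perm_on_mem[OF w] j')
  from dcosI[OF this d, where n = n]
  show "mmult n (mmult n b (perm_mat n w)) q \<in> dcos n (Borel n) (w \<circ> ?t) (Borel n)"
    unfolding * .
qed (use j in auto)

text \<open>The opposite case: a subdiagonal elementary factor crosses \<open>w\<close> to a lower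
  triangular one under the same inequality, so no transposition appears.\<close>

lemma closure_dcos_lower:
  assumes w: "perm_on n w" and j: "1 \<le> j" "Suc j \<le> n" and less: "w j < w (Suc j)"
  shows "closure (dcos n (Borel_minus n) w (Borel n))
    = closure (dcos n (Borel_minus n) w (parab n j (Suc j)))"
proof (rule closure_dcos_parab[where i = j])
  have j': "j \<in> {1..n}" "Suc j \<in> {1..n}" using j by auto
  show "dcos n (Borel_minus n) w (Borel n) \<subseteq> dcos n (Borel_minus n) w (parab n j (Suc j))"
    using Borel_subset_parab unfolding dcos_def by blast
  fix b q assume b: "b \<in> Borel_minus n" and q: "q \<in> parab n j (Suc j)" "q j j \<noteq> 0"
  obtain t d where d: "d \<in> Borel n" and qd: "q = mmult n (elm n t (Suc j) j) d"
    using parab_elm_decomp[OF q(1) j q(2)] .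
  let ?e = "elm n t (w (Suc j)) (w j)"
  have "mmult n (mmult n b (perm_mat n w)) q
      = mmult n b (mmult n (mmult n (perm_mat n w) (elm n t (Suc j) j)) d)"
    by (simp add: qd mmult_assoc)
  also have "mmult n (perm_mat n w) (elm n t (Suc j) j) = mmult n ?e (perm_mat n w)"
    by (intro perm_mat_elm w j')
  finally have *: "mmult n (mmult n b (perm_mat n w)) q
      = mmult n (mmult n (mmult n b ?e) (perm_mat n w)) d"
    by (simp add: mmult_assoc)
  have "mmult n b ?e \<in> Borel_minus n"
    by (intro Borel_minus_mmult elm_Borel_minus b less perm_on_mem[OF w] j')
  from dcosI[OF this d, where n = n]
  show "mmult n (mmult n b (perm_mat n w)) q \<in> dcos n (Borel_minus n) w (Borel n)"
    unfolding * .
qed (use j in auto)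

lemma uv_step_eq: "uv_step (u, v) X = (eps (lidx X) u, eps (hidx X) v)"
  by (cases X) auto

lemma eps_lidx_less:
  assumes "perm_on n w" "valid_letter (Suc n) (T j)"
  shows "eps j w j < eps j w (Suc j)"
proof -
  have "w j \<noteq> 0" using perm_on_mem[OF assms(1), of j] assms(2) by (auto simp: valid_letter_def)
  then show ?thesis by (simp add: eps_def)
qed

text \<open>Both Schubert conditions acquire the same insertion index \<open>lidx X\<close> and the
  same right stabiliser, although a letter \<open>T j\<close> treats u and v differently.\<close>

lemma closure_dcos_letter:
  assumes "perm_on n w" "valid_letter (Suc n) X"
  shows "closure (dcos (Suc n) (Borel (Suc n)) (eps (hidx X) w) (Borel (Suc n)))
      = closure (dcos (Suc n) (Borel (Suc n)) (eps (lidx X) w) (lparab (Suc n) X))" (is ?U)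
    and "closure (dcos (Suc n) (Borel_minus (Suc n)) (eps (lidx X) w) (Borel (Suc n)))
      = closure (dcos (Suc n) (Borel_minus (Suc n)) (eps (lidx X) w) (lparab (Suc n) X))" (is ?L)
proof -
  have "?U \<and> ?L"
  proof (cases X)
    case (R j)
    then show ?thesis by (simp add: Borel_eq_parab[of _ j])
  next
    case (T j)
    then have j: "1 \<le> j" "Suc j \<le> Suc n" "valid_letter (Suc n) (T j)"
      using assms(2) by (auto simp: valid_letter_def)
    \<comment> \<open>Inserting the value 1 one place later is the same as inserting it at
      \<open>j\<close> and exchanging the two neighbouring positions.\<close>
    have "eps (Suc j) w = eps j w \<circ> Transposition.transpose j (Suc j)"
      by (auto simp: eps_def Transposition.transpose_def fun_eq_iff)
    moreover have "perm_on (Suc n) (eps j w)"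
      using assms j by (intro perm_on_eps) auto
    ultimately show ?thesis
      using T closure_dcos_upper[of "eps j w" "Suc n" j] closure_dcos_lower[of "eps j w" "Suc n" j]
        eps_lidx_less[OF assms(1) j(3)] j by simp
  qed
  then show ?U ?L by auto
qed

subsection \<open>The first row of a matrix and the first column of its inverse\<close>

text \<open>The first row of a lower triangular matrix times \<open>w\<close> is supported in column
  \<open>j\<close>; a parabolic whose block starts at \<open>j\<close> cannot spread it to earlier
  columns.\<close>

lemma closure_lower_row:
  assumes w: "perm_on n w" and j: "j \<in> {1..n}" "w j = 1" and k: "k < j"
    and g: "g \<in> closure (dcos n (Borel_minus n) w (parab n j a))"
  shows "g 1 k = 0"
proof (rule closure_zero[OF continuous_on_entry g])
  fix y assume "y \<in> dcos n (Borel_minus n) w (parab n j a)"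
  then obtain b q where b: "b \<in> Borel_minus n" and q: "q \<in> parab n j a"
    and y: "y = mmult n (mmult n b (perm_mat n w)) q" by (rule dcosE)
  show "y 1 k = 0"
    unfolding y
  proof (rule mmult_zero)
    fix l assume l: "l \<in> {1..n}"
    show "mmult n b (perm_mat n w) 1 l * q l k = 0"
    proof (cases "l = j")
      case True
      then show ?thesis using parabD[OF q k] k by simp
    next
      case False
      then have "w l \<noteq> 1" using perm_on_eq_iff[OF w l j(1)] j(2) by simp
      then have "1 < w l" using perm_on_mem[OF w l] by simp
      then have "b 1 (w l) = 0" using b by (simp add: Borel_minus_def)
      then show ?thesis
        using mmult_perm_mat[OF w l GL_is_mat[OF Borel_minus_GL[OF b]]] by simp
    qed
  qed
qed

section \<open>Column replacement and Cramer's rule\<close>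

definition colrep :: "cmat \<Rightarrow> nat \<Rightarrow> (nat \<Rightarrow> complex) \<Rightarrow> cmat" where
  "colrep M k z = (\<lambda>i l. if l = k then z i else M i l)"

lemma is_mat_colrep:
  "is_mat n M \<Longrightarrow> k \<in> {1..n} \<Longrightarrow> (\<And>i. i \<notin> {1..n} \<Longrightarrow> z i = 0) \<Longrightarrow> is_mat n (colrep M k z)"
  by (auto simp: is_mat_def colrep_def)

text \<open>Matrix form of Cramer's rule: replacing column \<open>k\<close> of \<open>M\<close> by M
  z is right multiplication by the identity with column \<open>k\<close> replaced by
  \<open>z\<close>, which is singular when \<open>z k = 0\<close>.\<close>

lemma mmult_colrep:
  assumes M: "is_mat n M" and k: "k \<in> {1..n}"
  shows "mmult n M (colrep (idm n) k z) = colrep M k (\<lambda>i. \<Sum>l\<in>{1..n}. M i l * z l)"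
proof (rule is_mat_eqI[of n])
  show "is_mat n (colrep M k (\<lambda>i. \<Sum>l\<in>{1..n}. M i l * z l))"
    using is_mat_outside[OF M] by (intro is_mat_colrep M k sum.neutral) simp
  fix i l assume il: "i \<in> {1..n}" "l \<in> {1..n}"
  show "mmult n M (colrep (idm n) k z) i l = colrep M k (\<lambda>i. \<Sum>l\<in>{1..n}. M i l * z l) i l"
  proof (cases "l = k")
    case True
    then show ?thesis using il by (simp add: mmult_def colrep_def)
  next
    case False
    have "mmult n M (colrep (idm n) k z) i l = (\<Sum>m\<in>{l}. M i m * colrep (idm n) k z m l)"
      by (rule mmult_supp) (use il False in \<open>auto simp: colrep_def idm_def\<close>)
    then show ?thesis using False il by (simp add: colrep_def idm_def)
  qed
qed simp

lemma mdet_colrep_idm_zero: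
  assumes "k \<in> {1..n}" "z k = 0"
  shows "mdet n (colrep (idm n) k z) = 0"
  by (rule mdet_zero_row[OF assms(1)]) (use assms in \<open>auto simp: colrep_def idm_def\<close>)

lemma colrep_idm_GL:
  assumes k: "k \<in> {1..n}" and z: "z k \<noteq> 0" "\<And>i. i \<notin> {1..n} \<Longrightarrow> z i = 0"
  shows "colrep (idm n) k z \<in> GL n"
proof (rule GL_I)
  \<comment> \<open>Column \<open>k\<close> of the inverse, obtained by solving for the unit vector
    at \<open>k\<close>.\<close>
  let ?y = "\<lambda>i. if i = k then 1 / z k else - z i / z k"
  show m: "is_mat n (colrep (idm n) k z)"
    by (intro is_mat_colrep is_mat_idm k z)
  have "(\<Sum>l\<in>{1..n}. colrep (idm n) k z i l * ?y l) = idm n i k" for i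
  proof (cases "i \<in> {1..n}")
    case True
    have "(\<Sum>l\<in>{1..n}. colrep (idm n) k z i l * ?y l) = (\<Sum>l\<in>{i, k}. colrep (idm n) k z i l * ?y l)"
      by (rule sum.mono_neutral_right) (use True k in \<open>auto simp: colrep_def idm_def\<close>)
    also have "\<dots> = idm n i k"
      using True k z(1) by (cases "i = k") (auto simp: colrep_def idm_def)
    finally show ?thesis .
  next
    case False
    then have "colrep (idm n) k z i l = 0" for l using is_mat_outside[OF m] by blast
    moreover have "idm n i k = 0" using False by (auto simp: idm_def)
    ultimately show ?thesis by simp
  qed
  then have "mmult n (colrep (idm n) k z) (colrep (idm n) k ?y)
      = colrep (colrep (idm n) k z) k (\<lambda>i. idm n i k)"
    by (simp add: mmult_colrep[OF m k])
  also have "\<dots> = idm n"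
    by (auto simp: colrep_def fun_eq_iff)
  finally show "mmult n (colrep (idm n) k z) (colrep (idm n) k ?y) = idm n" .
qed

lemma continuous_on_colrep: "continuous_on UNIV (\<lambda>M. colrep M k z)"
  unfolding colrep_def
proof (intro continuous_on_cmatI)
  fix i l show "continuous_on UNIV (\<lambda>M :: cmat. if l = k then z i else M i l)"
    by (cases "l = k") (simp_all add: continuous_on_entry)
qed

text \<open>By Cramer's rule, the k-th entry of the first column of \<open>g\<^sup>-\<^sup>1\<close> vanishes iff the determinant of
  \<open>g\<close> with its k-th column replaced by the first unit vector does, which is a closed condition.\<close>

lemma closure_upper_inverse_col:
  assumes w: "perm_on n w" and X: "valid_letter n X" "w (lidx X) = 1" and k: "hidx X < k" "k \<le> n"
    and g: "g \<in> closure (dcos n (Borel n) w (lparab n X))" "g \<in> GL n"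
    and G: "is_mat n G" "mmult n g G = idm n"
  shows "G k 1 = 0"
proof (rule ccontr)
  let ?e = "\<lambda>i. idm n i 1"
  define j where "j = lidx X"
  have j: "j \<in> {1..n}" "j < k" "w j = 1"
    using X k lidx_le_hidx[of X] by (auto simp: valid_letter_def j_def)
  have k1: "k \<in> {1..n}" and one: "1 \<in> {1..n}" using j k by auto
  have "mdet n (colrep g k ?e) = 0"
  proof (rule closure_zero[OF continuous_on_compose2[OF continuous_on_mdet continuous_on_colrep] g(1)])
    fix y assume "y \<in> dcos n (Borel n) w (lparab n X)"
    then obtain b q where b: "b \<in> Borel n" and q: "q \<in> lparab n X"
      and y: "y = mmult n (mmult n b (perm_mat n w)) q" by (rule dcosE)
    obtain p where p: "p \<in> lparab n X" "mmult n q p = idm n"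
      using lparab_inverse[OF X(1) q] by blast
    have b11: "b 1 1 \<noteq> 0" by (rule Borel_diag[OF b one])
    have ym: "is_mat n y" by (simp add: y)
    \<comment> \<open>Cancelling \<open>q\<close> leaves \<open>b\<close> times \<open>w\<close>,
      whose column \<open>j\<close> is column 1 of \<open>b\<close>, a multiple of the first unit
      vector. Thus column \<open>j\<close> of \<open>p\<close>, divided by \<open>b 1 1\<close>,
      solves y z = e_1, and its entry at \<open>k\<close> is zero.\<close>
    have yp: "mmult n y p i j = b i 1" for i
      unfolding y mmult_assoc[of n _ q] p(2) mmult_idm_right[OF is_mat_mmult]
      using mmult_perm_mat[OF w j(1) GL_is_mat[OF Borel_GL[OF b]]] j(3) by simp
    have "(\<Sum>l\<in>{1..n}. y i l * (p l j / b 1 1)) = ?e i" for i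
    proof (cases "i \<in> {1..n}")
      case True
      have "(\<Sum>l\<in>{1..n}. y i l * (p l j / b 1 1)) = (\<Sum>l\<in>{1..n}. y i l * p l j) / b 1 1"
        by (simp add: sum_divide_distrib)
      also have "\<dots> = b i 1 / b 1 1"
        using yp[of i] True j(1) by (simp add: mmult_def)
      also have "\<dots> = ?e i"
        using b b11 True by (cases "i = 1") (auto simp: idm_def Borel_def)
      finally show ?thesis .
    next
      case False
      then show ?thesis using is_mat_outside[OF ym] by (auto simp: idm_def)
    qed
    then have "colrep y k ?e = mmult n y (colrep (idm n) k (\<lambda>l. p l j / b 1 1))"
      by (simp add: mmult_colrep[OF ym k1])
    moreover have "p k j = 0"
      using parabD[OF p(1) j(2)] k(1) by simp
    ultimately show "mdet n (colrep y k ?e) = 0"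
      by (simp add: mdet_mmult mdet_colrep_idm_zero[OF k1])
  qed auto
  moreover assume "G k 1 \<noteq> 0"
  then have "mdet n (colrep (idm n) k (\<lambda>l. G l 1)) \<noteq> 0"
    using colrep_idm_GL[OF k1, of "\<lambda>l. G l 1"] is_mat_outside[OF G(1)] by (simp add: GL_def)
  moreover have "(\<Sum>l\<in>{1..n}. g i l * G l 1) = ?e i" for i
  proof (cases "i \<in> {1..n}")
    case True
    then show ?thesis using fun_cong[OF fun_cong[OF G(2)], of i 1] one by (simp add: mmult_def)
  next
    case False
    then show ?thesis using is_mat_outside[OF GL_is_mat[OF g(2)]] by (auto simp: idm_def)
  qed
  then have "colrep g k ?e = mmult n g (colrep (idm n) k (\<lambda>l. G l 1))"
    by (simp add: mmult_colrep[OF GL_is_mat[OF g(2)] k1])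
  ultimately show False
    using g(2) by (simp add: mdet_mmult GL_def)
qed

subsection \<open>Splitting off a unit row and column\<close>

text \<open>Column \<open>j\<close> is first made the unit vector at 1 using the first column of the
  inverse, then row 1 is cleared by subtracting multiples of column \<open>j\<close>. The vanishing
  hypotheses place these two operations in the parabolic and the Borel subgroup.\<close>

lemma normalise_aux:
  assumes j: "j \<in> {1..Suc n}" "j \<le> a" and g: "g \<in> GL (Suc n)"
    and G: "is_mat (Suc n) G" "mmult (Suc n) g G = idm (Suc n)"
    and row: "\<And>k. k < j \<Longrightarrow> g 1 k = 0" and col: "\<And>k. a < k \<Longrightarrow> G k 1 = 0" and nz: "G j 1 \<noteq> 0"
  obtains q h where "q \<in> parab (Suc n) j a" "h \<in> GL n" "mmult (Suc n) g q = ins 1 j h"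
proof -
  let ?N = "Suc n"
  define q1 where "q1 = colrep (idm ?N) j (\<lambda>l. G l 1)"
  define q2 where "q2 = (\<lambda>i k. if i = j \<and> k \<noteq> j then - g 1 k else idm ?N i k)"
  have gm: "is_mat ?N g" by (rule GL_is_mat[OF g])
  have "q1 \<in> GL ?N"
    unfolding q1_def using is_mat_outside[OF G(1)] by (intro colrep_idm_GL j nz) simp
  then have q1: "q1 \<in> parab ?N j a"
    using col by (auto simp: parab_def q1_def colrep_def idm_def)
  have "is_mat ?N q2"
    using j is_mat_outside[OF gm] unfolding is_mat_def q2_def idm_def by auto
  then have q2: "q2 \<in> Borel ?N"
    using row unfolding Borel_iff by (auto simp: q2_def idm_def)
  then have "mmult ?N q1 q2 \<in> parab ?N j a"
    using q1 Borel_subset_parab by (intro parab_mmult) blast+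
  define g1 where "g1 = mmult ?N g q1"
  define g2 where "g2 = mmult ?N g1 q2"
  have "(\<Sum>l\<in>{1..?N}. g i l * G l 1) = idm ?N i 1" for i
  proof (cases "i \<in> {1..?N}")
    case True
    then show ?thesis using fun_cong[OF fun_cong[OF G(2)], of i 1] by (simp add: mmult_def)
  next
    case False
    then show ?thesis using is_mat_outside[OF gm] by (auto simp: idm_def)
  qed
  then have g1: "g1 i k = (if k = j then idm ?N i 1 else g i k)" for i k
    unfolding g1_def q1_def mmult_colrep[OF gm j(1)] by (simp add: colrep_def)
  have g2m: "is_mat ?N g2" by (simp add: g2_def)
  have g2j: "g2 i j = (if i = 1 then 1 else 0)" for i
  proof (cases "i \<in> {1..?N}")
    case True
    have "g2 i j = (\<Sum>l\<in>{j}. g1 i l * q2 l j)"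
      unfolding g2_def by (rule mmult_supp) (use True j in \<open>auto simp: q2_def idm_def\<close>)
    then show ?thesis using True j by (simp add: g1 q2_def idm_def)
  next
    case False
    then have "i \<noteq> 1" by auto
    then show ?thesis using is_mat_outside[OF g2m, of i j] False by simp
  qed
  have g2r: "g2 1 k = (if k = j then 1 else 0)" for k
  proof (cases "k \<in> {1..?N} \<and> k \<noteq> j")
    case True
    have "g2 1 k = (\<Sum>l\<in>{j, k}. g1 1 l * q2 l k)"
      unfolding g2_def by (rule mmult_supp) (use True j in \<open>auto simp: q2_def idm_def\<close>)
    then show ?thesis using True j by (simp add: g1 q2_def idm_def)
  next
    case False
    then show ?thesis using g2j[of 1] is_mat_outside[OF g2m, of 1 k] by (cases "k = j") auto
  qed
  have ins: "ins 1 j (del 1 j g2) = g2"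
    by (rule ins_del[OF g2r g2j])
  have "g2 \<in> GL ?N"
    unfolding g2_def g1_def by (intro GL_mmult g parab_GL[OF q1] Borel_GL[OF q2])
  then have "del 1 j g2 \<in> GL n"
    using ins_GL_D[of 1 j "del 1 j g2" n] j unfolding ins by simp
  moreover have "mmult ?N g (mmult ?N q1 q2) = g2"
    by (simp add: g2_def g1_def mmult_assoc)
  then have "mmult ?N g (mmult ?N q1 q2) = ins 1 j (del 1 j g2)"
    using ins by simp
  ultimately show thesis
    by (rule that[OF \<open>mmult ?N q1 q2 \<in> parab ?N j a\<close>])
qed

lemma normalise:
  assumes X: "valid_letter (Suc n) X" and g: "g \<in> GL (Suc n)"
    and G: "is_mat (Suc n) G" "mmult (Suc n) g G = idm (Suc n)"
    and row: "\<And>k. k < lidx X \<Longrightarrow> g 1 k = 0" and col: "\<And>k. hidx X < k \<Longrightarrow> G k 1 = 0"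
  obtains q h where "q \<in> lparab (Suc n) X" "h \<in> GL n" "mmult (Suc n) g q = ins 1 (lidx X) h"
proof -
  let ?N = "Suc n"
  define j where "j = lidx X"
  have j: "j \<in> {1..?N}" using X lidx_le_hidx[of X] by (auto simp: valid_letter_def j_def)
  have gm: "is_mat ?N g" by (rule GL_is_mat[OF g])
  show thesis
  proof (cases "G j 1 = 0")
    case False
    then show thesis
      using normalise_aux[OF j _ g G, of "hidx X"] row col lidx_le_hidx[of X] that
      unfolding j_def by blast
  next
    case True
    \<comment> \<open>Row 1 of \<open>g\<close> pairs with column 1 of \<open>G\<close> to 1, so
      some summand is nonzero. The vanishing conditions confine its index to the block, and it
      differs from \<open>j\<close>, which forces a letter \<open>T j\<close>.\<close>
    have "(\<Sum>l\<in>{1..?N}. g 1 l * G l 1) = 1"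
      using fun_cong[OF fun_cong[OF G(2)], of 1 1] by (simp add: mmult_def idm_def)
    then obtain l where l: "l \<in> {1..?N}" "g 1 l * G l 1 \<noteq> 0"
      by (metis (no_types, lifting) sum.neutral zero_neq_one)
    have "\<not> l < j" "\<not> hidx X < l" "l \<noteq> j"
      using l(2) row[of l] col[of l] True unfolding j_def by auto
    then obtain XT: "X = T j" and lj: "l = Suc j"
      by (cases X) (auto simp: j_def)
    have j2: "1 \<le> j" "Suc j \<le> ?N" using X XT by (auto simp: valid_letter_def)
    \<comment> \<open>Exchanging the two columns of the block moves the nonzero entry of the inverse
      to position \<open>j\<close>, which reduces to the case already treated.\<close>
    let ?s = "swp ?N j"
    let ?t = "Transposition.transpose j (Suc j)"
    have t: "?t k = k" if "k \<noteq> j" "k \<noteq> Suc j" for k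
      using that by (rule transpose_apply_other)
    have gs: "mmult ?N g ?s 1 k = 0" if "k < j" for k
      using that row[of k, folded j_def] by (simp add: mmult_swp[OF j2 gm] t)
    have sG: "mmult ?N ?s G k 1 = 0" if "Suc j < k" for k
      using that col[of k] XT by (simp add: swp_mmult[OF j2 G(1)] t)
    have sGj: "mmult ?N ?s G j 1 \<noteq> 0"
      using l(2) lj by (simp add: swp_mmult[OF j2 G(1)])
    have "mmult ?N (mmult ?N g ?s) (mmult ?N ?s G)
        = mmult ?N g (mmult ?N (mmult ?N ?s ?s) G)"
      by (simp add: mmult_assoc)
    also have "\<dots> = idm ?N" by (simp add: swp_swp[OF j2] G)
    finally have gsG: "mmult ?N (mmult ?N g ?s) (mmult ?N ?s G) = idm ?N" .
    obtain q h where q: "q \<in> parab ?N j (Suc j)" and h: "h \<in> GL n"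
      "mmult ?N (mmult ?N g ?s) q = ins 1 j h"
      by (rule normalise_aux[OF j _ GL_mmult[OF g swp_GL[OF j2]] is_mat_mmult gsG gs sG sGj]) auto
    have "mmult ?N ?s q \<in> lparab ?N X"
      using parab_mmult[OF swp_parab[OF j2] q] XT by simp
    moreover have "mmult ?N g (mmult ?N ?s q) = ins 1 (lidx X) h"
      using h(2) XT by (simp add: mmult_assoc)
    ultimately show thesis using that h(1) by blast
  qed
qed

subsection \<open>Inserting and deleting in closures of double cosets\<close>

lemma hidx_le: "hidx X \<le> Suc (lidx X)"
  by (cases X) auto

lemma Borel_GL_factors:
  assumes "mmult n (mmult n b g) q \<in> GL n" "is_mat n b" "is_mat n q"
  shows "b \<in> GL n" "q \<in> GL n"
  using assms by (auto simp: GL_def mdet_mmult)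

text \<open>The first column of an upper triangular matrix vanishes below row 1, and
  \<open>eps j v\<close> carries \<open>j\<close> to 1. Deletion is therefore multiplicative on the
  whole double coset.\<close>

lemma closure_upper_del:
  assumes v: "perm_on n v" and X: "valid_letter (Suc n) X" and h: "h \<in> GL n"
    and ih: "ins 1 (lidx X) h
      \<in> closure (dcos (Suc n) (Borel (Suc n)) (eps (lidx X) v) (lparab (Suc n) X))"
  shows "h \<in> closure (dcos n (Borel n) v (Borel n))"
proof -
  let ?N = "Suc n"
  define j where "j = lidx X"
  have j: "j \<in> {1..?N}" using X lidx_le_hidx[of X] by (auto simp: valid_letter_def j_def)
  have one: "1 \<in> {1..?N}" by simp
  have "del 1 j (ins 1 j h) \<in> closure (dcos n (Borel n) v (Borel n))"
  proof (rule closure_map_GL[OF continuous_on_del ih[folded j_def]])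
    show "del 1 j (ins 1 j h) \<in> GL n" using h by simp
    fix y assume yd: "y \<in> dcos ?N (Borel ?N) (eps j v) (parab ?N j (hidx X))" and nz: "mdet n (del 1 j y) \<noteq> 0"
    from yd obtain b q where b: "b \<in> Borel ?N" and q: "q \<in> parab ?N j (hidx X)"
      and y: "y = mmult ?N (mmult ?N b (perm_mat ?N (eps j v))) q" by (rule dcosE)
    have b0: "b (up 1 i) 1 = 0" for i
    proof -
      have "1 < up 1 i \<or> up 1 i = 0" by (auto simp: up_def)
      then show ?thesis
        using b is_mat_outside[OF GL_is_mat[OF Borel_GL[OF b]], of "up 1 i" 1] by (auto simp: Borel_def)
    qed
    have 1: "del 1 j (mmult ?N b (perm_mat ?N (eps j v))) = mmult n (del 1 1 b) (perm_mat n v)"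
      unfolding perm_mat_eps[OF v j]
      by (subst del_mmult[OF one one j]) (simp_all add: b0)
    have 2: "mmult ?N b (perm_mat ?N (eps j v)) (up 1 i) j = 0" for i
      using mmult_perm_mat[OF perm_on_eps[OF v j] j GL_is_mat[OF Borel_GL[OF b]]] b0
      by (simp add: eps_self)
    have dy: "del 1 j y = mmult n (mmult n (del 1 1 b) (perm_mat n v)) (del j j q)"
      unfolding y 1[symmetric] by (rule del_mmult[OF one j j]) (simp only: 2 mult_zero_left)
    have m: "is_mat n (del 1 1 b)" "is_mat n (del j j q)"
      using is_mat_del[OF GL_is_mat[OF Borel_GL[OF b]] one one]
        is_mat_del[OF GL_is_mat[OF parab_GL[OF q]] j j] by auto
    \<comment> \<open>The deleted parabolic factor may be singular; restricting to invertible images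
      makes both outer factors invertible.\<close>
    have "del 1 j y \<in> GL n" using nz unfolding GL_def dy by simp
    then have GL: "del 1 1 b \<in> GL n" "del j j q \<in> GL n"
      using Borel_GL_factors[OF _ m] unfolding dy by blast+
    have "del 1 1 b \<in> Borel n"
      using GL(1) b unfolding Borel_def del_def by simp
    \<comment> \<open>The only possibly nonzero subdiagonal entry of \<open>q\<close> lies in the
      deleted column \<open>j\<close>.\<close>
    moreover have "del j j q i k = 0" if "k < i" for i k
    proof -
      have "up j k < up j i" "\<not> (j \<le> up j k \<and> up j i \<le> hidx X)"
        using that hidx_le[of X] unfolding j_def[symmetric] by (auto simp: up_def)
      then show ?thesis unfolding del_def using parabD[OF q] by simp
    qed
    then have "del j j q \<in> Borel n"
      using GL(2) unfolding Borel_def by simp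
    ultimately show "del 1 j y \<in> dcos n (Borel n) v (Borel n)"
      unfolding dy by (rule dcosI)
  qed
  then show ?thesis by simp
qed

text \<open>The Schur complement of the (r, c) entry, scaled by that entry so that it is polynomial.\<close>

definition schur :: "nat \<Rightarrow> nat \<Rightarrow> cmat \<Rightarrow> cmat" where
  "schur r c M = (\<lambda>i k. M r c * M (up r i) (up c k) - M r (up c k) * M (up r i) c)"

lemma is_mat_schur:
  assumes "is_mat (Suc n) M" "r \<in> {1..Suc n}" "c \<in> {1..Suc n}"
  shows "is_mat n (schur r c M)"
  unfolding is_mat_def
proof (intro allI impI)
  fix i k assume "i \<notin> {1..n} \<or> k \<notin> {1..n}"
  then have "up r i \<notin> {1..Suc n} \<or> up c k \<notin> {1..Suc n}"
    using assms up_mem[of r n i] up_mem[of c n k] by simp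
  then have "M (up r i) (up c k) = 0" "M r (up c k) = 0 \<or> M (up r i) c = 0"
    using is_mat_outside[OF assms(1)] by blast+
  then show "schur r c M i k = 0" by (auto simp: schur_def)
qed

lemma continuous_on_schur: "continuous_on UNIV (schur r c)"
  unfolding schur_def by (intro continuous_on_cmatI continuous_intros continuous_on_entry)

lemma schur_ins [simp]: "schur r c (ins r c M) = M"
  by (simp add: schur_def)

text \<open>Entries of \<open>schur\<close> are 2 by 2 minors through the pivot. Since row
  \<open>r\<close> of \<open>A\<close> is supported at \<open>s\<close>, row \<open>r\<close> of the
  product is a multiple of row \<open>s\<close> of \<open>M\<close>, and only a scaled deletion of
  \<open>A\<close> survives.\<close>

lemma schur_mmult:
  assumes r: "r \<in> {1..Suc n}" and s: "s \<in> {1..Suc n}" and c: "c \<in> {1..Suc n}"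
    and A: "\<And>l. A r (up s l) = 0"
  shows "schur r c (mmult (Suc n) A M) = mmult n (\<lambda>i k. A r s * del r s A i k) (schur s c M)"
proof (rule is_mat_eqI[of n])
  show "is_mat n (schur r c (mmult (Suc n) A M))"
    by (intro is_mat_schur is_mat_mmult r c)
  fix i k assume ik: "i \<in> {1..n}" "k \<in> {1..n}"
  then have u: "up r i \<in> {1..Suc n}" "up c k \<in> {1..Suc n}"
    using r c up_mem[of r n i] up_mem[of c n k] by auto
  have row: "mmult (Suc n) A M r l = A r s * M s l" if "l \<in> {1..Suc n}" for l
    using mmult_up[OF s r that, of A M] A by simp
  let ?S = "\<lambda>l. \<Sum>m\<in>{1..n}. A (up r i) (up s m) * M (up s m) l"
  have "schur r c (mmult (Suc n) A M) i k
      = A r s * M s c * (A (up r i) s * M s (up c k) + ?S (up c k))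
        - A r s * M s (up c k) * (A (up r i) s * M s c + ?S c)"
    unfolding schur_def row[OF c] row[OF u(2)] mmult_up[OF s u] mmult_up[OF s u(1) c] ..
  \<comment> \<open>The terms containing column \<open>s\<close> of \<open>A\<close> cancel in the
    minor.\<close>
  also have "\<dots> = A r s * (M s c * ?S (up c k) - M s (up c k) * ?S c)"
    by (simp add: algebra_simps)
  also have "\<dots> = (\<Sum>m\<in>{1..n}. A r s * A (up r i) (up s m) * schur s c M m k)"
    unfolding sum_distrib_left sum_subtractf[symmetric] schur_def
    by (intro sum.cong) (simp_all add: algebra_simps)
  also have "\<dots> = mmult n (\<lambda>i k. A r s * del r s A i k) (schur s c M) i k"
    using ik by (simp add: mmult_def del_def)
  finally show "schur r c (mmult (Suc n) A M) i k
      = mmult n (\<lambda>i k. A r s * del r s A i k) (schur s c M) i k" .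
qed simp

text \<open>For a lower triangular left factor only the first row is a multiple of a unit vector, so
  plain deletion is not multiplicative; the Schur complement is, by
  \<open>schur_mmult\<close>.\<close>

lemma closure_lower_del:
  assumes u: "perm_on n u" and X: "valid_letter (Suc n) X" and h: "h \<in> GL n"
    and ih: "ins 1 (lidx X) h
      \<in> closure (dcos (Suc n) (Borel_minus (Suc n)) (eps (lidx X) u) (lparab (Suc n) X))"
  shows "h \<in> closure (dcos n (Borel_minus n) u (Borel n))"
proof -
  let ?N = "Suc n"
  define j where "j = lidx X"
  have j: "j \<in> {1..?N}" using X lidx_le_hidx[of X] by (auto simp: valid_letter_def j_def)
  have one: "1 \<in> {1..?N}" by simp
  have "schur 1 j (ins 1 j h) \<in> closure (dcos n (Borel_minus n) u (Borel n))"
  proof (rule closure_map_GL[OF continuous_on_schur ih[folded j_def]])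
    show "schur 1 j (ins 1 j h) \<in> GL n" using h by simp
    fix y assume yd: "y \<in> dcos ?N (Borel_minus ?N) (eps j u) (parab ?N j (hidx X))"
      and nz: "mdet n (schur 1 j y) \<noteq> 0"
    from yd obtain b q where b: "b \<in> Borel_minus ?N" and q: "q \<in> parab ?N j (hidx X)"
      and y: "y = mmult ?N (mmult ?N b (perm_mat ?N (eps j u))) q" by (rule dcosE)
    define c where "c = (\<lambda>i k. b 1 1 * del 1 1 b i k)"
    have b0: "b 1 (up 1 l) = 0" for l
    proof -
      have "1 < up 1 l \<or> up 1 l = 0" by (auto simp: up_def)
      then show ?thesis
        using b is_mat_outside[OF GL_is_mat[OF Borel_minus_GL[OF b]], of 1 "up 1 l"]
        by (auto simp: Borel_minus_def)
    qed
    have sy: "schur 1 j y = mmult n (mmult n c (perm_mat n u)) (schur j j q)"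
      unfolding y mmult_assoc perm_mat_eps[OF u j] c_def
      by (subst schur_mmult[where A = b, OF one one j b0], subst schur_mmult[OF one j j]) simp_all
    have m: "is_mat n c" "is_mat n (schur j j q)"
      using is_mat_del[OF GL_is_mat[OF Borel_minus_GL[OF b]] one one]
        is_mat_schur[OF GL_is_mat[OF parab_GL[OF q]] j j] unfolding c_def is_mat_def by auto
    have "schur 1 j y \<in> GL n" using nz unfolding GL_def sy by simp
    then have GL: "c \<in> GL n" "schur j j q \<in> GL n"
      using Borel_GL_factors[OF _ m] unfolding sy by blast+
    have "c \<in> Borel_minus n"
      using GL(1) b unfolding Borel_minus_def c_def del_def by simp
    moreover have "schur j j q i k = 0" if ki: "k < i" for i k
    proof -
      have "up j k < up j i" "\<not> (j \<le> up j k \<and> up j i \<le> hidx X)"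
        using ki hidx_le[of X] unfolding j_def[symmetric] by (auto simp: up_def)
      then have 1: "q (up j i) (up j k) = 0" using parabD[OF q] by simp
      \<comment> \<open>The correction term of the minor vanishes below the diagonal as well: either
        its row factor lies left of the block or its column factor lies below it.\<close>
      have "q j (up j k) * q (up j i) j = 0"
      proof (cases "k < j")
        case True
        then have "up j k < j" by (simp add: up_def)
        then show ?thesis using parabD[OF q, of "up j k" j] by simp
      next
        case False
        then have "j < up j i" "hidx X < up j i"
          using ki hidx_le[of X] unfolding j_def[symmetric] by (auto simp: up_def)
        then show ?thesis using parabD[OF q, of j "up j i"] by simp
      qed
      with 1 show ?thesis by (simp add: schur_def)
    qed
    then have "schur j j q \<in> Borel n"
      using GL(2) unfolding Borel_def by simp
    ultimately show "schur 1 j y \<in> dcos n (Borel_minus n) u (Borel n)"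
      unfolding sy by (rule dcosI)
  qed
  then show ?thesis by simp
qed

text \<open>Insertion splits over the factors of b w d, and the inserted Borel factor merges with
  \<open>q\<close> in the parabolic. The sets \<open>A\<close> and \<open>A'\<close> stand for Borel
  subgroups of either sign in the two sizes.\<close>

lemma closure_ins:
  assumes w: "perm_on n w" and X: "valid_letter (Suc n) X" and q: "q \<in> lparab (Suc n) X"
    and A: "\<And>b. b \<in> A \<Longrightarrow> is_mat n b \<and> ins 1 1 b \<in> A'"
    and h: "h \<in> closure (dcos n A w (Borel n))"
  shows "mmult (Suc n) (ins 1 (lidx X) h) q
    \<in> closure (dcos (Suc n) A' (eps (lidx X) w) (lparab (Suc n) X))"
proof -
  let ?N = "Suc n"
  define j where "j = lidx X"
  have j: "j \<in> {1..?N}" using X lidx_le_hidx[of X] by (auto simp: valid_letter_def j_def)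
  have one: "1 \<in> {1..?N}" by simp
  have "continuous_on UNIV (\<lambda>h. mmult ?N (ins 1 j h) q)"
    by (rule continuous_on_compose2[OF continuous_on_mmult_right continuous_on_ins]) simp
  then have "mmult ?N (ins 1 j h) q \<in> closure (dcos ?N A' (eps j w) (lparab ?N X))"
  proof (rule closure_map[OF _ h])
    fix y assume "y \<in> dcos n A w (Borel n)"
    then obtain b d where b: "b \<in> A" and d: "d \<in> Borel n"
      and y: "y = mmult n (mmult n b (perm_mat n w)) d" by (rule dcosE)
    have dm: "is_mat n d" by (rule GL_is_mat[OF Borel_GL[OF d]])
    have "mmult ?N (mmult ?N (ins 1 1 b) (ins 1 j (perm_mat n w))) (ins j j d) = ins 1 j y"
      using A[OF b] dm j by (simp add: mmult_ins y)
    then have *: "mmult ?N (ins 1 j y) q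
        = mmult ?N (mmult ?N (ins 1 1 b) (perm_mat ?N (eps j w))) (mmult ?N (ins j j d) q)"
      by (simp only: perm_mat_eps[OF w j] mmult_assoc[symmetric])
    have "mmult ?N (ins j j d) q \<in> lparab ?N X"
      using ins_Borel[OF d j] Borel_subset_parab by (intro parab_mmult q) blast
    then have "mmult ?N (ins 1 j y) q \<in> dcos ?N A' (eps j w) (lparab ?N X)"
      unfolding * using A[OF b] by (intro dcosI) simp_all
    then show "mmult ?N (ins 1 j y) q \<in> closure (dcos ?N A' (eps j w) (lparab ?N X))"
      by (rule subsetD[OF closure_subset])
  qed
  then show ?thesis by (simp add: j_def)
qed

lemma closure_dcos_mmult_right:
  assumes "q \<in> parab n a c" "g \<in> closure (dcos n A w (parab n a c))"
  shows "mmult n g q \<in> closure (dcos n A w (parab n a c))"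
proof (rule closure_mmult_right[OF assms(2)])
  fix y assume "y \<in> dcos n A w (parab n a c)"
  then obtain b p where b: "b \<in> A" and p: "p \<in> parab n a c"
    and y: "y = mmult n (mmult n b (perm_mat n w)) p" by (rule dcosE)
  from dcosI[OF b parab_mmult[OF p assms(1)], where n = n]
  show "mmult n y q \<in> dcos n A w (parab n a c)"
    unfolding y by (simp only: mmult_assoc)
qed

subsection \<open>One letter acting on Richardson varieties\<close>

text \<open>For one inclusion an element of P normalises \<open>g\<close> and both conditions
  descend to the smaller matrix; for the other both conditions survive insertion and right
  multiplication by P.\<close>

lemma Union_richardson_letter:
  assumes u: "perm_on n u" and v: "perm_on n v" and X: "valid_letter (Suc n) X"
  shows "\<Union>(richardson (Suc n) (eps (hidx X) v) (eps (lidx X) u))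
    = {mmult (Suc n) (ins 1 (lidx X) h) q | h q. h \<in> \<Union>(richardson n v u) \<and> q \<in> lparab (Suc n) X}"
    (is "_ = ?R")
proof -
  let ?N = "Suc n"
  let ?P = "lparab ?N X"
  define j where "j = lidx X"
  \<comment> \<open>Both conditions are taken in the form that is stable under the same P, so a
    single normalising element keeps \<open>g\<close> inside both closures.\<close>
  define U where "U = closure (dcos ?N (Borel ?N) (eps j v) ?P)"
  define L where "L = closure (dcos ?N (Borel_minus ?N) (eps j u) ?P)"
  have j: "j \<in> {1..?N}" and hj: "hidx X \<in> {1..?N}"
    using X lidx_le_hidx[of X] by (auto simp: valid_letter_def j_def)
  have "\<Union>(richardson ?N (eps (hidx X) v) (eps j u)) = U \<inter> L \<inter> GL ?N"
    using Union_richardson[OF perm_on_eps[OF v hj] perm_on_eps[OF u j]]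
      closure_dcos_letter(1)[OF v X] closure_dcos_letter(2)[OF u X]
    unfolding U_def L_def j_def by simp
  also have "\<dots> = ?R"
  proof (intro equalityI subsetI)
    fix g assume "g \<in> U \<inter> L \<inter> GL ?N"
    then have gU: "g \<in> U" and gL: "g \<in> L" and g: "g \<in> GL ?N" by auto
    obtain G where G: "G \<in> GL ?N" "mmult ?N g G = idm ?N" using GL_inverse[OF g] by blast
    have row: "g 1 k = 0" if "k < lidx X" for k
      using closure_lower_row[OF perm_on_eps[OF u j] j eps_self, of k g "hidx X"] gL that
      by (simp add: L_def j_def)
    have col: "G k 1 = 0" if "hidx X < k" for k
    proof (cases "k \<le> ?N")
      case True
      then show ?thesis
        using closure_upper_inverse_col[OF perm_on_eps[OF v j] X _ that True _ g GL_is_mat[OF G(1)] G(2)] gU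
        by (simp add: U_def j_def eps_self)
    next
      case False
      then show ?thesis using is_mat_outside[OF GL_is_mat[OF G(1)], of k 1] by simp
    qed
    obtain q h where q: "q \<in> ?P" and h: "h \<in> GL n" "mmult ?N g q = ins 1 j h"
      unfolding j_def by (rule normalise[OF X g GL_is_mat[OF G(1)] G(2) row col])
    obtain p where p: "p \<in> ?P" "mmult ?N q p = idm ?N"
      using lparab_inverse[OF X q] by blast
    have "mmult ?N (ins 1 j h) p = g"
      unfolding h(2)[symmetric] mmult_assoc p(2) by (simp add: GL_is_mat[OF g])
    moreover have "ins 1 j h \<in> U" "ins 1 j h \<in> L"
      unfolding h(2)[symmetric] U_def L_def
      using gU gL q by (auto simp: U_def L_def intro: closure_dcos_mmult_right)
    then have "h \<in> \<Union>(richardson n v u)"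
      unfolding Union_richardson[OF v u] U_def L_def j_def
      using closure_upper_del[OF v X h(1)] closure_lower_del[OF u X h(1)] h(1) by blast
    ultimately show "g \<in> ?R" using p(1) unfolding j_def by blast
  next
    fix g assume "g \<in> ?R"
    then obtain h q where h: "h \<in> \<Union>(richardson n v u)" and q: "q \<in> ?P"
      and g: "g = mmult ?N (ins 1 j h) q" unfolding j_def by blast
    have hU: "h \<in> closure (dcos n (Borel n) v (Borel n))"
      and hL: "h \<in> closure (dcos n (Borel_minus n) u (Borel n))" and hG: "h \<in> GL n"
      using h unfolding Union_richardson[OF v u] by auto
    have "g \<in> U"
      unfolding g U_def j_def
      by (rule closure_ins[OF v X q _ hU]) (simp add: ins_Borel GL_is_mat Borel_GL)
    moreover have "g \<in> L"
      unfolding g L_def j_def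
      by (rule closure_ins[OF u X q _ hL]) (simp add: ins_Borel_minus GL_is_mat Borel_minus_GL)
    moreover have "g \<in> GL ?N"
      unfolding g using j by (intro GL_mmult ins_GL hG parab_GL[OF q]) simp_all
    ultimately show "g \<in> U \<inter> L \<inter> GL ?N" by blast
  qed
  finally show ?thesis by (simp add: j_def)
qed

subsection \<open>Commutation of letters\<close>

fun shift_letter :: "letter \<Rightarrow> letter" where
  "shift_letter (R j) = R (Suc j)"
| "shift_letter (T j) = T (Suc j)"

lemma lidx_shift [simp]: "lidx (shift_letter X) = Suc (lidx X)"
  by (cases X) auto

lemma hidx_shift [simp]: "hidx (shift_letter X) = Suc (hidx X)"
  by (cases X) auto

text \<open>All four relations have the form A B = B A+, where A+ is \<open>A\<close> shifted by one
  and the block of \<open>B\<close> ends no later than the block of \<open>A\<close> begins.\<close>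

lemma th_rel_cases:
  assumes "th_rel x y"
  obtains A B where "x = [A, B]" "y = [B, shift_letter A]" "1 \<le> lidx B" "hidx B \<le> lidx A"
  using assms
proof cases
  case (TT j i)
  then show thesis using that[of "T i" "T j"] by simp
next
  case (TR j i)
  then show thesis using that[of "T i" "R j"] by simp
next
  case (RT j i)
  then show thesis using that[of "R i" "T j"] by simp
next
  case (RR j i)
  then show thesis using that[of "R i" "R j"] by simp
qed

text \<open>Inserting at or before the start of a block shifts the whole block by one;
  \<open>ins_levi_above\<close> covers insertion beyond its end, which leaves it in place.\<close>

lemma ins_levi_below:
  assumes "1 \<le> j" "j \<le> lidx A" "hidx A \<le> n"
  shows "ins j j ` levi n A = levi (Suc n) (shift_letter A)"
proof -
  have j: "j \<in> {1..Suc n}" using assms lidx_le_hidx[of A] by simp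
  show ?thesis
  proof (cases A)
    case (R i)
    then show ?thesis using j by (simp add: ins_idm)
  next
    case (T i)
    then have "up j i = Suc i" "up j (Suc i) = Suc (Suc i)" "j \<noteq> Suc i"
      using assms by (simp_all add: up_def)
    then show ?thesis
      using T j by (simp add: image_image ins_elm ins_swp)
  qed
qed

lemma ins_levi_above:
  assumes "hidx B < k" "k \<le> Suc n"
  shows "ins k k ` levi n B = levi (Suc n) B"
proof -
  have k: "k \<in> {1..Suc n}" using assms by simp
  show ?thesis
  proof (cases B)
    case (R i)
    then show ?thesis using k by (simp add: ins_idm)
  next
    case (T i)
    then have "up k i = i" "up k (Suc i) = Suc i" "k \<noteq> Suc i"
      using assms by (simp_all add: up_def)
    then show ?thesis
      using T k by (simp add: image_image ins_elm ins_swp)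
  qed
qed

lemma swp_elm_commute:
  assumes j: "1 \<le> j" "Suc j \<le> n" and p: "p \<in> {1..n}" "q \<in> {1..n}"
    and "p \<notin> {j, Suc j}" "q \<notin> {j, Suc j}"
  shows "mmult n (swp n j) (elm n a p q) = mmult n (elm n a p q) (swp n j)"
proof -
  let ?t = "Transposition.transpose j (Suc j)"
  have "?t p = p" "?t q = q" using assms by simp_all
  moreover have "perm_on n ?t" using j by (intro perm_on_transpose) auto
  ultimately show ?thesis unfolding swp_def using perm_mat_elm[of ?t n p q a] p by simp
qed

lemma levi_commute:
  assumes X: "valid_letter n X" and Y: "valid_letter n Y" and less: "hidx X < lidx Y"
    and r: "r \<in> levi n X" and s: "s \<in> levi n Y"
  shows "mmult n r s = mmult n s r"
proof -
  have m: "is_mat n r" "is_mat n s"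
    using levi_subset[OF X r] levi_subset[OF Y s] by (auto intro: GL_is_mat parab_GL)
  show ?thesis
  proof (cases X)
    case (R j)
    then show ?thesis using r m by simp
  next
    case XT: (T j)
    show ?thesis
    proof (cases Y)
      case (R i)
      then show ?thesis using s m by simp
    next
      case (T i)
      have j: "1 \<le> j" "Suc j \<le> n" and i: "1 \<le> i" "Suc i \<le> n" and ij: "Suc j < i"
        using X Y less XT T by (auto simp: valid_letter_def)
      consider "r = swp n j" "s = swp n i" | a where "r = swp n j" "s = elm n a (Suc i) i"
        | a where "r = elm n a (Suc j) j" "s = swp n i"
        | a b where "r = elm n a (Suc j) j" "s = elm n b (Suc i) i"
        using r s XT T by auto
      then show ?thesis
      proof cases
        case 1
        have "Transposition.transpose j (Suc j) \<circ> Transposition.transpose i (Suc i)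
            = Transposition.transpose i (Suc i) \<circ> Transposition.transpose j (Suc j)"
          using ij by (auto simp: fun_eq_iff Transposition.transpose_def)
        moreover have "perm_on n (Transposition.transpose j (Suc j))"
          "perm_on n (Transposition.transpose i (Suc i))"
          using i j by (auto intro!: perm_on_transpose)
        ultimately show ?thesis
          unfolding 1 swp_def by (simp add: perm_mat_compose del: One_nat_def)
      next
        case 2
        then show ?thesis using swp_elm_commute[of j n "Suc i" i] i j ij by simp
      next
        case 3
        then show ?thesis using swp_elm_commute[of i n "Suc j" j] i j ij by simp
      next
        case (4 a b)
        have s: "is_mat n s" by (rule m)
        \<comment> \<open>One product is a row operation on \<open>s\<close>, the other a column
          operation. Row \<open>j\<close> and column \<open>Suc j\<close> of \<open>s\<close> are
          unit vectors because the blocks are disjoint, so both add the same entry.\<close>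
        have "mmult n r s = (\<lambda>x k. s x k + (if x = Suc j then a * s j k else 0))"
          unfolding 4(1) using j s by (intro elm_mmult) auto
        moreover have "mmult n s r = (\<lambda>x k. s x k + (if k = j then a * s x (Suc j) else 0))"
          unfolding 4(1) using j s by (intro mmult_elm) auto
        ultimately show ?thesis
          using ij i j by (auto simp: 4 elm_def idm_def fun_eq_iff)
      qed
    qed
  qed
qed

section \<open>Composition of letter operations on subsets of \<open>GL\<close>\<close>

definition letter_op :: "nat \<Rightarrow> letter \<Rightarrow> cmat set \<Rightarrow> cmat set" where
  "letter_op n X Y = {mmult n (ins (lidx X) (lidx X) h) q | h q. h \<in> Y \<and> q \<in> lparab n X}"

text \<open>Normal form for two letters: the Borel part of the inner parabolic passes through the
  outer insertion and is absorbed by the outer parabolic, leaving two sets of representatives and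
  one final Borel factor.\<close>

lemma letter_op_letter_op:
  assumes Y: "\<forall>h\<in>Y. is_mat n h"
    and A: "valid_letter (Suc n) A" and B: "valid_letter (Suc (Suc n)) B"
  shows "letter_op (Suc (Suc n)) B (letter_op (Suc n) A Y) =
    {mmult (Suc (Suc n)) (ins (lidx B) (lidx B) (ins (lidx A) (lidx A) h))
       (mmult (Suc (Suc n)) r (mmult (Suc (Suc n)) s b)) | h r s b.
     h \<in> Y \<and> r \<in> ins (lidx B) (lidx B) ` levi (Suc n) A \<and> s \<in> levi (Suc (Suc n)) B
       \<and> b \<in> Borel (Suc (Suc n))}" (is "_ = ?W")
proof (intro equalityI subsetI)
  let ?N = "Suc n" and ?K = "Suc (Suc n)"
  let ?i = "lidx A" and ?j = "lidx B"
  have i: "?i \<in> {1..?N}" using A lidx_le_hidx[of A] by (auto simp: valid_letter_def)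
  have j: "?j \<in> {1..?K}" using B lidx_le_hidx[of B] by (auto simp: valid_letter_def)
  have im: "is_mat ?N (ins ?i ?i h)" if "h \<in> Y" for h
    by (rule is_mat_ins[OF bspec[OF Y that] i i])
  {
    fix x assume "x \<in> letter_op ?K B (letter_op ?N A Y)"
    then obtain h q q' where h: "h \<in> Y" and q: "q \<in> lparab ?N A" and q': "q' \<in> lparab ?K B"
      and x: "x = mmult ?K (ins ?j ?j (mmult ?N (ins ?i ?i h) q)) q'"
      unfolding letter_op_def by blast
    obtain r b where r: "r \<in> levi ?N A" and b: "b \<in> Borel ?N" and qr: "q = mmult ?N r b"
      using levi_decomp[OF A q] .
    \<comment> \<open>The absorbed product is decomposed afresh into an outer representative and a
      Borel element.\<close>
    have "mmult ?K (ins ?j ?j b) q' \<in> lparab ?K B"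
      using ins_Borel[OF b j] Borel_subset_parab by (intro parab_mmult q') blast
    then obtain s c where s: "s \<in> levi ?K B" and c: "c \<in> Borel ?K"
      and sc: "mmult ?K (ins ?j ?j b) q' = mmult ?K s c"
      using levi_decomp[OF B] by blast
    have rm: "is_mat ?N r" "is_mat ?N b"
      using GL_is_mat[OF parab_GL[OF levi_subset[OF A r]]] GL_is_mat[OF Borel_GL[OF b]] by auto
    have "ins ?j ?j (mmult ?N (ins ?i ?i h) q)
        = mmult ?K (ins ?j ?j (ins ?i ?i h)) (mmult ?K (ins ?j ?j r) (ins ?j ?j b))"
      unfolding qr using j by (simp add: mmult_ins im[OF h] rm)
    then have "x = mmult ?K (ins ?j ?j (ins ?i ?i h)) (mmult ?K (ins ?j ?j r) (mmult ?K s c))"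
      unfolding x by (simp add: mmult_assoc sc)
    then show "x \<in> ?W" using h r s c by blast
  next
    fix x assume "x \<in> ?W"
    then obtain h r s b where h: "h \<in> Y" and r: "r \<in> levi ?N A" and s: "s \<in> levi ?K B"
      and b: "b \<in> Borel ?K"
      and x: "x = mmult ?K (ins ?j ?j (ins ?i ?i h)) (mmult ?K (ins ?j ?j r) (mmult ?K s b))"
      by blast
    have rm: "r \<in> lparab ?N A" by (rule levi_subset[OF A r])
    have "mmult ?K s b \<in> lparab ?K B"
      using b Borel_subset_parab by (intro parab_mmult levi_subset[OF B s]) blast
    moreover have "mmult ?N (ins ?i ?i h) r \<in> letter_op ?N A Y"
      unfolding letter_op_def using h rm by blast
    moreover have "x = mmult ?K (ins ?j ?j (mmult ?N (ins ?i ?i h) r)) (mmult ?K s b)"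
      using mmult_ins[OF im[OF h] GL_is_mat[OF parab_GL[OF rm]] j j j]
      unfolding x by (simp add: mmult_assoc[symmetric])
    ultimately show "x \<in> letter_op ?K B (letter_op ?N A Y)"
      unfolding letter_op_def[of ?K] by blast
  }
qed

text \<open>Guarantees that rewriting by a relation preserves the index bounds of
  \<open>RTSeq\<close> in both directions.\<close>

lemma valid_letter_swap:
  assumes "1 \<le> lidx B" "hidx B \<le> lidx A"
  shows "valid_letter n A \<and> valid_letter (Suc n) B
    \<longleftrightarrow> valid_letter n B \<and> valid_letter (Suc n) (shift_letter A)"
  using assms lidx_le_hidx[of A] lidx_le_hidx[of B] by (auto simp: valid_letter_def)

text \<open>In the normal form, the insertions agree by \<open>ins_ins\<close>, the sets of
  representatives are exchanged by the \<open>ins_levi\<close> lemmas, and representatives of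
  disjoint blocks commute.\<close>

lemma letter_op_swap:
  assumes Y: "\<forall>h\<in>Y. is_mat n h"
    and A: "valid_letter (Suc n) A" and B: "1 \<le> lidx B" "hidx B \<le> lidx A"
  shows "letter_op (Suc (Suc n)) B (letter_op (Suc n) A Y)
    = letter_op (Suc (Suc n)) (shift_letter A) (letter_op (Suc n) B Y)"
proof -
  let ?N = "Suc n" and ?K = "Suc (Suc n)"
  let ?i = "lidx A" and ?j = "lidx B"
  have ij: "?j \<le> ?i" using B lidx_le_hidx[of B] by simp
  have iN: "hidx A \<le> ?N" using A by (simp add: valid_letter_def)
  have vB: "valid_letter ?N B" "valid_letter ?K B"
    using iN B lidx_le_hidx[of A] by (auto simp: valid_letter_def)
  have vA: "valid_letter ?K (shift_letter A)" using A by (simp add: valid_letter_def)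
  have 1: "ins ?j ?j ` levi ?N A = levi ?K (shift_letter A)"
    using B ij iN by (intro ins_levi_below)
  have 2: "ins (Suc ?i) (Suc ?i) ` levi ?N B = levi ?K B"
    using B iN lidx_le_hidx[of A] by (intro ins_levi_above) auto
  have 3: "mmult ?K r (mmult ?K s b) = mmult ?K s (mmult ?K r b)"
    if "r \<in> levi ?K (shift_letter A)" "s \<in> levi ?K B" for r s b
  proof -
    have "mmult ?K s r = mmult ?K r s"
      using levi_commute[OF vB(2) vA _ that(2,1)] B by simp
    then show ?thesis by (simp only: mmult_assoc[symmetric])
  qed
  have 4: "ins ?j ?j (ins ?i ?i h) = ins (Suc ?i) (Suc ?i) (ins ?j ?j h)" for h
    by (rule ins_ins[OF ij])
  show ?thesis
    unfolding letter_op_letter_op[OF Y A vB(2)] letter_op_letter_op[OF Y vB(1) vA]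
      lidx_shift 1 2 4
    using 3 by (intro Collect_cong) metis
qed

subsection \<open>Words\<close>

lemma RTSeq_iff:
  "w \<in> RTSeq n \<longleftrightarrow> length w = n \<and> (\<forall>k<n. valid_letter (Suc k) (w ! k))"
proof -
  have "((\<exists>j. X = R j \<and> 1 \<le> j \<and> j \<le> Suc k) \<or> (\<exists>j. X = T j \<and> 1 \<le> j \<and> j \<le> k))
      \<longleftrightarrow> valid_letter (Suc k) X" for X k
    by (cases X) (auto simp: valid_letter_def)
  then show ?thesis by (simp add: RTSeq_def)
qed

lemma RTSeq_snoc:
  "w @ [X] \<in> RTSeq m \<longleftrightarrow> (\<exists>n. m = Suc n \<and> w \<in> RTSeq n \<and> valid_letter (Suc n) X)"
  by (cases m) (auto simp: RTSeq_iff nth_append less_Suc_eq)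

lemma u_of_snoc: "u_of (w @ [X]) = eps (lidx X) (u_of w)"
  using uv_step_eq[of "fst (uv w)" "snd (uv w)" X] by (simp add: u_of_def uv_def)

lemma v_of_snoc: "v_of (w @ [X]) = eps (hidx X) (v_of w)"
  using uv_step_eq[of "fst (uv w)" "snd (uv w)" X] by (simp add: v_of_def uv_def)

lemma perm_on_uv:
  assumes "w \<in> RTSeq n"
  shows "perm_on n (u_of w)" "perm_on n (v_of w)"
proof -
  have "perm_on n (u_of w) \<and> perm_on n (v_of w)"
    using assms
  proof (induction w arbitrary: n rule: rev_induct)
    case Nil
    then show ?case by (simp add: RTSeq_def bij_betw_def)
  next
    case (snoc X w)
    then obtain m where m: "n = Suc m" "w \<in> RTSeq m" "valid_letter (Suc m) X"
      unfolding RTSeq_snoc by blast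
    then have "lidx X \<in> {1..Suc m}" "hidx X \<in> {1..Suc m}"
      using lidx_le_hidx[of X] by (auto simp: valid_letter_def)
    then show ?case
      unfolding u_of_snoc v_of_snoc m(1) using snoc.IH[OF m(2)] by (intro conjI perm_on_eps) auto
  qed
  then show "perm_on n (u_of w)" "perm_on n (v_of w)" by auto
qed

text \<open>The preimage in \<open>GL\<close> of the translated Richardson variety from the
  theorem.\<close>

definition twisted :: "nat \<Rightarrow> letter list \<Rightarrow> cmat set" where
  "twisted n w = mmult n (perm_mat n (perm_inv n (u_of w))) ` \<Union>(X_of n w)"

text \<open>Translation by the inverse of u removes u from the recursion: it turns insertion at (1,
  j) into insertion at (j, j), so only the appended letter enters.\<close>

lemma twisted_snoc:
  assumes w: "w \<in> RTSeq n" and X: "valid_letter (Suc n) X"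
  shows "twisted (Suc n) (w @ [X]) = letter_op (Suc n) X (twisted n w)"
proof -
  let ?N = "Suc n" and ?j = "lidx X" and ?u = "u_of w" and ?v = "v_of w"
  let ?u' = "eps ?j ?u"
  let ?p = "perm_mat n ?u" and ?p' = "perm_mat n (perm_inv n ?u)"
  have j: "?j \<in> {1..?N}" using X lidx_le_hidx[of X] by (auto simp: valid_letter_def)
  note uv = perm_on_uv[OF w]
  have one: "1 \<in> {1..?N}" by simp
  have *: "mmult ?N (perm_mat ?N (perm_inv ?N ?u')) (mmult ?N (ins 1 ?j g) q)
      = mmult ?N (ins ?j ?j (mmult n ?p' g)) q" if g: "g \<in> GL n" for g q
  proof -
    \<comment> \<open>Writing \<open>g\<close> as u times its translate splits the matrix of the new
      u off \<open>ins 1 ?j g\<close>; the new inverse then cancels it.\<close>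
    have "mmult n ?p (mmult n ?p' g) = g"
      by (simp only: mmult_assoc[symmetric] perm_mat_perm_inv(2)[OF uv(1)] mmult_idm[OF GL_is_mat[OF g]])
    then have "ins 1 ?j g = mmult ?N (ins 1 ?j ?p) (ins ?j ?j (mmult n ?p' g))"
      using j one by (simp add: mmult_ins)
    then have "mmult ?N (perm_mat ?N (perm_inv ?N ?u')) (ins 1 ?j g)
        = mmult ?N (mmult ?N (perm_mat ?N (perm_inv ?N ?u')) (perm_mat ?N ?u')) (ins ?j ?j (mmult n ?p' g))"
      by (simp only: perm_mat_eps[OF uv(1) j] mmult_assoc)
    also have "\<dots> = ins ?j ?j (mmult n ?p' g)"
      using perm_mat_perm_inv(1)[OF perm_on_eps[OF uv(1) j]] is_mat_ins[OF is_mat_mmult j j] by simp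
    finally show ?thesis by (simp only: mmult_assoc[symmetric])
  qed
  have GL: "g \<in> GL n" if "g \<in> \<Union>(X_of n w)" for g
    using that unfolding X_of_def Union_richardson[OF uv(2,1)] by blast
  have UX: "\<Union>(X_of ?N (w @ [X]))
      = {mmult ?N (ins 1 ?j h) q | h q. h \<in> \<Union>(X_of n w) \<and> q \<in> lparab ?N X}"
    unfolding X_of_def u_of_snoc v_of_snoc by (rule Union_richardson_letter[OF uv X])
  have "twisted ?N (w @ [X]) = {mmult ?N (perm_mat ?N (perm_inv ?N ?u')) (mmult ?N (ins 1 ?j h) q)
      | h q. h \<in> \<Union>(X_of n w) \<and> q \<in> lparab ?N X}"
    unfolding twisted_def u_of_snoc UX by blast
  also have "\<dots> = {mmult ?N (ins ?j ?j (mmult n ?p' h)) q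
      | h q. h \<in> \<Union>(X_of n w) \<and> q \<in> lparab ?N X}"
    using * GL by (intro Collect_cong) metis
  also have "\<dots> = letter_op ?N X (twisted n w)"
    unfolding letter_op_def twisted_def by blast
  finally show ?thesis .
qed

lemma is_mat_twisted: "\<forall>h\<in>twisted n w. is_mat n h"
  by (auto simp: twisted_def)

text \<open>The left context supplies the set on which \<open>letter_op_swap\<close> acts, and the
  right context is added letter by letter. Membership in \<open>RTSeq\<close> is carried along to
  justify each use of the recursion.\<close>

lemma twisted_th_rel:
  assumes "th_rel x y"
  shows "(a @ x @ c \<in> RTSeq m \<longleftrightarrow> a @ y @ c \<in> RTSeq m)
    \<and> (a @ x @ c \<in> RTSeq m \<longrightarrow> twisted m (a @ x @ c) = twisted m (a @ y @ c))"
proof (induction c arbitrary: m rule: rev_induct)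
  case Nil
  obtain A B where AB: "x = [A, B]" "y = [B, shift_letter A]" "1 \<le> lidx B" "hidx B \<le> lidx A"
    using th_rel_cases[OF assms] .
  have x: "a @ x @ [] = (a @ [A]) @ [B]" and y: "a @ y @ [] = (a @ [B]) @ [shift_letter A]"
    by (simp_all add: AB)
  have "twisted m (a @ x @ []) = twisted m (a @ y @ [])" if m: "a @ x @ [] \<in> RTSeq m"
  proof -
    obtain n where n: "m = Suc (Suc n)" "a \<in> RTSeq n" "valid_letter (Suc n) A"
      "valid_letter (Suc (Suc n)) B"
      using m unfolding x RTSeq_snoc by blast
    then have v: "valid_letter (Suc n) B" "valid_letter (Suc (Suc n)) (shift_letter A)"
      using valid_letter_swap[OF AB(3,4)] by blast+
    have aA: "a @ [A] \<in> RTSeq (Suc n)" and aB: "a @ [B] \<in> RTSeq (Suc n)"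
      using n v unfolding RTSeq_snoc by blast+
    show ?thesis
      unfolding x y n(1) twisted_snoc[OF aA n(4)] twisted_snoc[OF n(2,3)]
        twisted_snoc[OF aB v(2)] twisted_snoc[OF n(2) v(1)]
      by (rule letter_op_swap[OF is_mat_twisted n(3) AB(3,4)])
  qed
  moreover have "a @ x @ [] \<in> RTSeq m \<longleftrightarrow> a @ y @ [] \<in> RTSeq m"
    unfolding x y RTSeq_snoc using valid_letter_swap[OF AB(3,4)] by blast
  ultimately show ?case by blast
next
  case (snoc X c)
  have assoc: "a @ z @ c @ [X] = (a @ z @ c) @ [X]" for z by simp
  show ?case
    unfolding assoc RTSeq_snoc using snoc.IH twisted_snoc by metis
qed

text \<open>A derivation in the monoid passes through intermediate words; the equivalence of
  memberships keeps them in \<open>RTSeq\<close> and makes the symmetric and transitive cases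
  work.\<close>

lemma twisted_th_eq:
  assumes "th_eq w w'"
  shows "(w \<in> RTSeq n \<longleftrightarrow> w' \<in> RTSeq n) \<and> (w \<in> RTSeq n \<longrightarrow> twisted n w = twisted n w')"
  using assms
proof induction
  case (step x y a b)
  then show ?case by (rule twisted_th_rel)
qed auto

section \<open>Return from subsets of \<open>GL\<close> to subsets of the flag variety\<close>

lemma Union_act: "\<Union>(act n g S) = mmult n g ` \<Union>S"
  by (auto simp: act_def)

lemma act_subset_Fl:
  assumes "S \<subseteq> Fl n" "g \<in> GL n"
  shows "act n g S \<subseteq> Fl n"
proof
  fix D assume "D \<in> act n g S"
  then obtain C where C: "C \<in> S" "D = mmult n g ` C" by (auto simp: act_def)
  then obtain h where h: "h \<in> GL n" "C = coset n h" using assms(1) by (auto simp: Fl_def)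
  have "D = coset n (mmult n g h)"
    unfolding C(2) h(2) coset_def image_image by (simp add: mmult_assoc)
  then show "D \<in> Fl n" using GL_mmult[OF assms(2) h(1)] by (simp add: Fl_def)
qed

theorem mainTheorem3:
  assumes "\<Omega> \<in> RTSeq n" and "\<Omega>' \<in> RTSeq n" and "th_eq \<Omega> \<Omega>'"
  shows "act n (perm_mat n (perm_inv n (u_of \<Omega>))) (X_of n \<Omega>)
       = act n (perm_mat n (perm_inv n (u_of \<Omega>'))) (X_of n \<Omega>')"
proof (rule Fl_Union_eqD)
  have "act n (perm_mat n (perm_inv n (u_of w))) (X_of n w) \<subseteq> Fl n" if "w \<in> RTSeq n" for w
    unfolding X_of_def
    by (intro act_subset_Fl richardson_subset_Fl perm_mat_GL perm_on_perm_inv perm_on_uv(1) that)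
  with assms(1,2) show "act n (perm_mat n (perm_inv n (u_of \<Omega>))) (X_of n \<Omega>) \<subseteq> Fl n"
    "act n (perm_mat n (perm_inv n (u_of \<Omega>'))) (X_of n \<Omega>') \<subseteq> Fl n" by blast+
  show "\<Union>(act n (perm_mat n (perm_inv n (u_of \<Omega>))) (X_of n \<Omega>))
      = \<Union>(act n (perm_mat n (perm_inv n (u_of \<Omega>'))) (X_of n \<Omega>'))"
    unfolding Union_act twisted_def[symmetric] using twisted_th_eq[OF assms(3)] assms(1) by blast
qed

end
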